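(* Every cell system on $\mathcal{E}_2^{(12)}$ is equivalent either to the solution $W^+$ or to the inequivalent (conjugate) solution $W^-$, given for $l=1,2,3$ by $$W_{i,j,k}^{\pm}=\sqrt{[2][3]},\qquad W_{p_l,j,k}^{\pm}=\frac{[2]\sqrt{[3]}}{\sqrt{[4]}},$$ $$W_{p_l,q_{l-1},r_l}^{\pm}=\frac{\sqrt{[2]}^3}{[4]}\sqrt{[2]^2\pm\sqrt{[2][4]}},\qquad W_{p_l,q_l,r_{l+1}}^{\pm}=-\frac{\sqrt{[2]}^3}{[4]}\sqrt{[2]^2\mp\sqrt{[2][4]}},$$ $$W_{p_l,q_l,k}^{\pm}=W_{p_l,j,r_{l+1}}^{\pm}=\frac{\sqrt{[2]}^3}{[4]}\sqrt{[2][4]\pm\sqrt{[2][4]}},$$ $$W_{p_l,q_{l-1},k}^{\pm}=W_{p_l,j,r_l}^{\pm}=\frac{\sqrt{[2]}^3}{[4]}\sqrt{[2][4]\mp\sqrt{[2][4]}}.$$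
   Context: Let $q=e^{\pi i/12}$ and $[m]=(q^m-q^{-m})/(q-q^{-1})$. The graph $\mathcal{E}_2^{(12)}$ has vertices $i,j,k$ and $p_l,q_l,r_l$ for $l=1,2,3$ (indices mod 3), and exactly the following edges (one each, for $l=1,2,3$): $i\to j$, $j\to k$, $k\to i$, $p_l\to j$, $k\to p_l$, $j\to r_l$, $q_l\to k$, $p_l\to q_l$, $p_l\to q_{l-1}$, $q_l\to r_{l+1}$, $r_l\to p_l$, $r_{l+1}\to p_l$. Its Perron-Frobenius eigenvector (eigenvalue $[3]$) is $\phi_i=1$, $\phi_j=\phi_k=[3]$, $\phi_{p_l}=[2]^3/[4]$, $\phi_{q_l}=\phi_{r_l}=[2][3]/[4]$. $W_{a,b,c}$ denotes the value of $W$ on the triangle $a\to b\to c\to a$. Cell systems: let $\mathcal{G}$ be a directed graph (loops and multiple edges allowed), with source and range maps $s,r$, Perron-Frobenius eigenvalue $[3]$ and positive Perron-Frobenius eigenvector $(\phi_i)$. A triangle $\triangle_{ijk}^{(\alpha\beta\gamma)}$ is a closed path $i\xrightarrow{\alpha}j\xrightarrow{\beta}k\xrightarrow{\gamma}i$ ($i,j,k$ arbitrary vertices), considered up to cyclic rotation. A cell system $W$ assigns to each triangle a complex number $W(\triangle_{ijk}^{(\alpha\beta\gamma)})$ such that: (I) for all edges $\alpha,\alpha'$ from $i$ to $j$, $\sum_{k,\beta,\gamma}W(\triangle_{ijk}^{(\alpha\beta\gamma)})\overline{W(\triangle_{ijk}^{(\alpha'\beta\gamma)})}=\delta_{\alpha,\alpha'}[2]\phi_i\phi_j$,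 the sum being over vertices $k$ and edges $\beta:j\to k$, $\gamma:k\to i$; (II) for all edges $\alpha_1,\dots,\alpha_4$ with $s(\alpha_1)=s(\alpha_4)=i_1$, $r(\alpha_1)=r(\alpha_2)=i_2$, $s(\alpha_2)=s(\alpha_3)=i_3$, $r(\alpha_3)=r(\alpha_4)=i_4$, $$\sum\phi_k^{-1}W(\triangle_{i_1i_2k}^{(\alpha_1\beta_1\beta_2)})\overline{W(\triangle_{i_3i_2k}^{(\alpha_2\beta_1\beta_3)})}W(\triangle_{i_3i_4k}^{(\alpha_3\beta_4\beta_3)})\overline{W(\triangle_{i_1i_4k}^{(\alpha_4\beta_4\beta_2)})}=\delta_{\alpha_1,\alpha_4}\delta_{\alpha_2,\alpha_3}\phi_{i_1}\phi_{i_2}\phi_{i_3}+\delta_{\alpha_1,\alpha_2}\delta_{\alpha_3,\alpha_4}\phi_{i_1}\phi_{i_2}\phi_{i_4},$$ the sum being over vertices $k$ and edges $\beta_1:i_2\to k$, $\beta_2:k\to i_1$, $\beta_3:k\to i_3$, $\beta_4:i_4\to k$. Two cell systems $W_1,W_2$ on $\mathcal{G}$ are equivalent if for each pair of adjacent vertices $i,j$ there is a unitary matrix $(u(\sigma,\sigma'))$ indexed by the edges from $i$ to $j$ such that for every triangle $W_1(\triangle_{ijk}^{(\sigma\rho\gamma)})=\sum_{\sigma',\rho',\gamma'}u(\sigma,\sigma')u(\rho,\rho')u(\gamma,\gamma')W_2(\triangle_{ijk}^{(\sigma'\rho'\gamma')})$, summing over edges $\sigma':i\to j$, $\rho':j\to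 k$, $\gamma':k\to i$. *)

theory Defs
  imports Complex_Main "HOL-Library.Numeral_Type" "Graph_Theory.Digraph"
begin

section \<open>Quantum integers at \<open>q = exp (\<i> \<pi> / 12)\<close>\<close>

definition qroot :: complex where
  "qroot = exp (\<i> * of_real (pi / 12))"

text \<open>The quotient defining \<open>[m]\<close> is real (lemma \<open>of_real_qint\<close> below), so \<open>Re\<close>
  only changes its type.\<close>

definition qint :: "nat \<Rightarrow> real" where
  "qint m = Re ((qroot ^ m - inverse (qroot ^ m)) / (qroot - inverse qroot))"

lemma qint_quotient:
  "(qroot ^ m - inverse (qroot ^ m)) / (qroot - inverse qroot)
     = of_real (sin (real m * pi / 12) / sin (pi / 12))"
proof -
  have q: "qroot = cis (pi / 12)"
    by (simp add: qroot_def cis_conv_exp)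
  have *: "cis x - inverse (cis x) = 2 * \<i> * of_real (sin x)" for x :: real
    by (simp add: complex_eq_iff)
  have qm: "qroot ^ m = cis (real m * pi / 12)"
    by (simp add: q DeMoivre)
  show ?thesis
    unfolding qm unfolding q * by simp
qed

lemma of_real_qint:
  "of_real (qint m) = (qroot ^ m - inverse (qroot ^ m)) / (qroot - inverse qroot)"
  by (simp add: qint_def qint_quotient del: of_real_divide)

lemma qint_sin: "qint m = sin (real m * pi / 12) / sin (pi / 12)"
  by (simp add: qint_def qint_quotient del: of_real_divide)


section \<open>Cell systems on a finite directed multigraph\<close>

text \<open>A positive eigenvector of the adjacency matrix (summing over the arcs out of a vertex);
  on a finite strongly connected graph its eigenvalue is the Perron-Frobenius eigenvalue.\<close>

definition perron_frobenius_vec ::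
    "('a, 'b) pre_digraph \<Rightarrow> real \<Rightarrow> ('a \<Rightarrow> real) \<Rightarrow> bool" where
  "perron_frobenius_vec G \<mu> \<phi> \<longleftrightarrow>
     (\<forall>v\<in>verts G. \<phi> v > 0) \<and>
     (\<forall>v\<in>verts G. (\<Sum>e\<in>out_arcs G v. \<phi> (head G e)) = \<mu> * \<phi> v)"

definition triangle :: "('a, 'b) pre_digraph \<Rightarrow> 'b \<Rightarrow> 'b \<Rightarrow> 'b \<Rightarrow> bool" where
  "triangle G a b c \<longleftrightarrow>
     a \<in> arcs G \<and> b \<in> arcs G \<and> c \<in> arcs G \<and>
     head G a = tail G b \<and> head G b = tail G c \<and> head G c = tail G a"

definition arcs_between :: "('a, 'b) pre_digraph \<Rightarrow> 'a \<Rightarrow> 'a \<Rightarrow> 'b set" where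
  "arcs_between G i j = {e \<in> arcs G. tail G e = i \<and> head G e = j}"

definition cell_type_I ::
    "('a, 'b) pre_digraph \<Rightarrow> ('a \<Rightarrow> real) \<Rightarrow> ('b \<Rightarrow> 'b \<Rightarrow> 'b \<Rightarrow> complex) \<Rightarrow> bool" where
  "cell_type_I G \<phi> W \<longleftrightarrow>
     (\<forall>i\<in>verts G. \<forall>j\<in>verts G. \<forall>a\<in>arcs_between G i j. \<forall>a'\<in>arcs_between G i j.
        (\<Sum>(b, c)\<in>{(b, c). triangle G a b c}. W a b c * cnj (W a' b c))
          = (if a = a' then of_real (qint 2 * \<phi> i * \<phi> j) else 0))"

text \<open>In the following sum the four triangle conditions say exactly that, for
  \<open>k = head b1\<close>, the arcs run \<open>b1 : i2 \<rightarrow> k\<close>, \<open>b2 : k \<rightarrow> i1\<close>,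
  \<open>b3 : k \<rightarrow> i3\<close>, \<open>b4 : i4 \<rightarrow> k\<close>.\<close>

definition cell_type_II ::
    "('a, 'b) pre_digraph \<Rightarrow> ('a \<Rightarrow> real) \<Rightarrow> ('b \<Rightarrow> 'b \<Rightarrow> 'b \<Rightarrow> complex) \<Rightarrow> bool" where
  "cell_type_II G \<phi> W \<longleftrightarrow>
     (\<forall>i1\<in>verts G. \<forall>i2\<in>verts G. \<forall>i3\<in>verts G. \<forall>i4\<in>verts G.
      \<forall>a1\<in>arcs_between G i1 i2. \<forall>a2\<in>arcs_between G i3 i2.
      \<forall>a3\<in>arcs_between G i3 i4. \<forall>a4\<in>arcs_between G i1 i4.
        (\<Sum>(b1, b2, b3, b4)\<in>{(b1, b2, b3, b4).
              triangle G a1 b1 b2 \<and> triangle G a2 b1 b3 \<and>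
              triangle G a3 b4 b3 \<and> triangle G a4 b4 b2}.
            of_real (inverse (\<phi> (head G b1))) *
              W a1 b1 b2 * cnj (W a2 b1 b3) * W a3 b4 b3 * cnj (W a4 b4 b2))
          = (if a1 = a4 \<and> a2 = a3 then of_real (\<phi> i1 * \<phi> i2 * \<phi> i3) else 0)
          + (if a1 = a2 \<and> a3 = a4 then of_real (\<phi> i1 * \<phi> i2 * \<phi> i4) else 0))"

text \<open>Triangles up to rotation are represented by \<open>W\<close> being invariant under rotation;
  the values of \<open>W\<close> at triples of arcs that do not form a triangle are irrelevant.
  The graph is meant to be finite with \<open>perron_frobenius_vec G (qint 3) \<phi>\<close>.\<close>

definition cell_system ::
    "('a, 'b) pre_digraph \<Rightarrow> ('a \<Rightarrow> real) \<Rightarrow> ('b \<Rightarrow> 'b \<Rightarrow> 'b \<Rightarrow> complex) \<Rightarrow> bool" where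
  "cell_system G \<phi> W \<longleftrightarrow>
     (\<forall>a b c. triangle G a b c \<longrightarrow> W a b c = W b c a) \<and>
     cell_type_I G \<phi> W \<and> cell_type_II G \<phi> W"

definition unitary_on :: "'b set \<Rightarrow> ('b \<Rightarrow> 'b \<Rightarrow> complex) \<Rightarrow> bool" where
  "unitary_on S u \<longleftrightarrow>
     (\<forall>x\<in>S. \<forall>y\<in>S. (\<Sum>z\<in>S. u x z * cnj (u y z)) = (if x = y then 1 else 0)) \<and>
     (\<forall>x\<in>S. \<forall>y\<in>S. (\<Sum>z\<in>S. cnj (u z x) * u z y) = (if x = y then 1 else 0))"

definition cell_equiv ::
    "('a, 'b) pre_digraph \<Rightarrow> ('b \<Rightarrow> 'b \<Rightarrow> 'b \<Rightarrow> complex) \<Rightarrow>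
     ('b \<Rightarrow> 'b \<Rightarrow> 'b \<Rightarrow> complex) \<Rightarrow> bool" where
  "cell_equiv G W1 W2 \<longleftrightarrow>
     (\<exists>u :: 'a \<Rightarrow> 'a \<Rightarrow> 'b \<Rightarrow> 'b \<Rightarrow> complex.
        (\<forall>i\<in>verts G. \<forall>j\<in>verts G. unitary_on (arcs_between G i j) (u i j)) \<and>
        (\<forall>i\<in>verts G. \<forall>j\<in>verts G. \<forall>k\<in>verts G.
         \<forall>a\<in>arcs_between G i j. \<forall>b\<in>arcs_between G j k. \<forall>c\<in>arcs_between G k i.
           W1 a b c =
             (\<Sum>a'\<in>arcs_between G i j. \<Sum>b'\<in>arcs_between G j k. \<Sum>c'\<in>arcs_between G k i.
                u i j a a' * u j k b b' * u k i c c' * W2 a' b' c')))"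


section \<open>The graph \<open>E_2^(12)\<close>\<close>

text \<open>The index type \<open>3\<close> is the ring of integers modulo 3.\<close>

datatype E2_vertex = Vi | Vj | Vk | Vp "3" | Vq "3" | Vr "3"

definition E2_12 :: "(E2_vertex, E2_vertex \<times> E2_vertex) pre_digraph" where
  "E2_12 = \<lparr>
     verts = UNIV,
     arcs = {(Vi, Vj), (Vj, Vk), (Vk, Vi)} \<union>
       (\<Union>l. {(Vp l, Vj), (Vk, Vp l), (Vj, Vr l), (Vq l, Vk),
             (Vp l, Vq l), (Vp l, Vq (l - 1)), (Vq l, Vr (l + 1)),
             (Vr l, Vp l), (Vr (l + 1), Vp l)}),
     tail = fst,
     head = snd\<rparr>"

fun E2_phi :: "E2_vertex \<Rightarrow> real" where
  "E2_phi Vi = 1"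
| "E2_phi Vj = qint 3"
| "E2_phi Vk = qint 3"
| "E2_phi (Vp l) = qint 2 ^ 3 / qint 4"
| "E2_phi (Vq l) = qint 2 * qint 3 / qint 4"
| "E2_phi (Vr l) = qint 2 * qint 3 / qint 4"

text \<open>\<open>E2_W_val \<epsilon> x y z\<close> is the value on the triangle \<open>x \<rightarrow> y \<rightarrow> z \<rightarrow> x\<close> for
  \<open>x = i\<close> or \<open>x = p_l\<close>. The sign \<open>\<epsilon> = 1\<close> or \<open>\<epsilon> = -1\<close> is the upper or lower choice
  of \<open>\<plusminus>\<close>. Every triangle of the graph contains exactly one vertex among \<open>i\<close> and the
  \<open>p_l\<close>, so \<open>E2_W\<close> obtains the remaining values by rotation.\<close>

fun E2_W_val :: "real \<Rightarrow> E2_vertex \<Rightarrow> E2_vertex \<Rightarrow> E2_vertex \<Rightarrow> real" where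
  "E2_W_val \<epsilon> Vi Vj Vk = sqrt (qint 2 * qint 3)"
| "E2_W_val \<epsilon> (Vp l) Vj Vk = qint 2 * sqrt (qint 3) / sqrt (qint 4)"
| "E2_W_val \<epsilon> (Vp l) (Vq m) (Vr n) =
     (if m = l - 1 \<and> n = l then
        sqrt (qint 2) ^ 3 / qint 4 * sqrt (qint 2 ^ 2 + \<epsilon> * sqrt (qint 2 * qint 4))
      else if m = l \<and> n = l + 1 then
        - (sqrt (qint 2) ^ 3 / qint 4 * sqrt (qint 2 ^ 2 - \<epsilon> * sqrt (qint 2 * qint 4)))
      else 0)"
| "E2_W_val \<epsilon> (Vp l) (Vq m) Vk =
     (if m = l then
        sqrt (qint 2) ^ 3 / qint 4 * sqrt (qint 2 * qint 4 + \<epsilon> * sqrt (qint 2 * qint 4))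
      else if m = l - 1 then
        sqrt (qint 2) ^ 3 / qint 4 * sqrt (qint 2 * qint 4 - \<epsilon> * sqrt (qint 2 * qint 4))
      else 0)"
| "E2_W_val \<epsilon> (Vp l) Vj (Vr n) =
     (if n = l + 1 then
        sqrt (qint 2) ^ 3 / qint 4 * sqrt (qint 2 * qint 4 + \<epsilon> * sqrt (qint 2 * qint 4))
      else if n = l then
        sqrt (qint 2) ^ 3 / qint 4 * sqrt (qint 2 * qint 4 - \<epsilon> * sqrt (qint 2 * qint 4))
      else 0)"
| "E2_W_val \<epsilon> _ _ _ = 0"

fun E2_base :: "E2_vertex \<Rightarrow> bool" where
  "E2_base Vi = True"
| "E2_base (Vp l) = True"
| "E2_base _ = False"

definition E2_W ::
    "real \<Rightarrow> E2_vertex \<times> E2_vertex \<Rightarrow> E2_vertex \<times> E2_vertex \<Rightarrow> E2_vertex \<times> E2_vertex \<Rightarrow> complex"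
  where
  "E2_W \<epsilon> a b c =
     (let x = tail E2_12 a; y = tail E2_12 b; z = tail E2_12 c in
      of_real (if E2_base x then E2_W_val \<epsilon> x y z
               else if E2_base y then E2_W_val \<epsilon> y z x
               else E2_W_val \<epsilon> z x y))"

definition E2_W_plus ::
    "E2_vertex \<times> E2_vertex \<Rightarrow> E2_vertex \<times> E2_vertex \<Rightarrow> E2_vertex \<times> E2_vertex \<Rightarrow> complex" where
  "E2_W_plus = E2_W 1"

definition E2_W_minus ::
    "E2_vertex \<times> E2_vertex \<Rightarrow> E2_vertex \<times> E2_vertex \<Rightarrow> E2_vertex \<times> E2_vertex \<Rightarrow> complex" where
  "E2_W_minus = E2_W (- 1)"


section \<open>\<open>E2_phi\<close> is the Perron-Frobenius eigenvector of \<open>E_2^(12)\<close>\<close>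

lemma fin_digraph_E2_12: "fin_digraph E2_12"
proof
  have "(UNIV :: E2_vertex set) = {Vi, Vj, Vk} \<union> range Vp \<union> range Vq \<union> range Vr"
    by (auto, metis E2_vertex.exhaust rangeI)
  then have "finite (UNIV :: E2_vertex set)"
    by (metis finite.emptyI finite.insertI finite_UnI finite_imageI finite)
  then show "finite (verts E2_12)"
    by (simp add: E2_12_def)
  show "finite (arcs E2_12)"
    by (simp add: E2_12_def)
qed (auto simp: E2_12_def)

lemma qint_2_sq: "qint 2 ^ 2 = 2 + sqrt 3"
  and qint_2_pos: "qint 2 > 0"
  and qint_3: "qint 3 = 1 + sqrt 3"
  and qint_4: "qint 4 = qint 2 * sqrt 3"
proof -
  define s c where "s = sin (pi / 12)" and "c = cos (pi / 12)"
  have s: "s > 0" and c: "c > 0"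
    unfolding s_def c_def by (auto intro!: sin_gt_zero cos_gt_zero)
  have "cos (2 * (pi / 12)) = 2 * c ^ 2 - 1"
    unfolding c_def by (rule cos_double_cos)
  then have c2: "4 * c ^ 2 = 2 + sqrt 3"
    by (simp add: cos_30)
  have "sin (2 * (pi / 12)) = 2 * s * c"
    unfolding s_def c_def by (rule sin_double)
  then have sc: "sin (pi / 6) = 2 * s * c"
    by simp
  have c30: "cos (pi / 6) = 2 * c ^ 2 - 1"
    using c2 by (simp add: cos_30)
  have q2: "qint 2 = 2 * c"
    using s sc by (simp add: qint_sin s_def[symmetric])
  have pi4: "pi / 4 = pi / 6 + pi / 12"
    by simp
  have "sin (pi / 4) = sin (pi / 6) * c + cos (pi / 6) * s"
    by (simp only: pi4 sin_add s_def c_def)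
  then have "sin (pi / 4) = s * (4 * c ^ 2 - 1)"
    unfolding sc c30 by (simp add: algebra_simps power2_eq_square)
  then show "qint 3 = 1 + sqrt 3"
    using s c2 by (simp add: qint_sin s_def[symmetric])
  have "sin (2 * (pi / 6)) = 2 * sin (pi / 6) * cos (pi / 6)"
    by (rule sin_double)
  then have "sin (pi / 3) = 2 * c * s * sqrt 3"
    unfolding sc cos_30 by (simp add: algebra_simps)
  then show "qint 4 = qint 2 * sqrt 3"
    using s q2 by (simp add: qint_sin s_def[symmetric])
  show "qint 2 ^ 2 = 2 + sqrt 3" "qint 2 > 0"
    using q2 c2 c by (simp_all add: power_mult_distrib)
qed

lemma perron_frobenius_E2_12: "perron_frobenius_vec E2_12 (qint 3) E2_phi"
proof -
  define a where "a = qint 2"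
  define r :: real where "r = sqrt 3"
  have r: "r > 0" "r * r = 3" by (simp_all add: r_def)
  have a: "a > 0" "a * a = 2 + r"
    using qint_2_pos qint_2_sq by (simp_all add: a_def r_def power2_eq_square)
  have q: "qint 2 = a" "qint 3 = 1 + r" "qint 4 = a * r"
    by (simp_all add: a_def r_def qint_3 qint_4)
  have p: "a ^ 3 / (a * r) = (2 + r) / r" and qr: "a * (1 + r) / (a * r) = (1 + r) / r"
    using a by (simp_all add: power3_eq_cube)
  have pos: "E2_phi v > 0" for v
    using a r by (cases v) (simp_all add: q add_pos_pos)
  have ne: "l - 1 \<noteq> l" "l \<noteq> l - 1" for l :: 3 by auto
  have out: "out_arcs E2_12 v = (case v of
       Vi \<Rightarrow> {(Vi, Vj)}
     | Vj \<Rightarrow> insert (Vj, Vk) ((\<lambda>l. (Vj, Vr l)) ` UNIV)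
     | Vk \<Rightarrow> insert (Vk, Vi) ((\<lambda>l. (Vk, Vp l)) ` UNIV)
     | Vp l \<Rightarrow> {(Vp l, Vj), (Vp l, Vq l), (Vp l, Vq (l - 1))}
     | Vq l \<Rightarrow> {(Vq l, Vk), (Vq l, Vr (l + 1))}
     | Vr l \<Rightarrow> {(Vr l, Vp l), (Vr l, Vp (l - 1))})" for v
    by (cases v) (auto simp: out_arcs_def E2_12_def algebra_simps, (metis diff_add_cancel)+)
  have "(\<Sum>e\<in>out_arcs E2_12 v. E2_phi (head E2_12 e)) = qint 3 * E2_phi v" for v
  proof -
    have h: "head E2_12 = snd" by (simp add: E2_12_def)
    have "inj (\<lambda>l. (Vj, Vr l))" "inj (\<lambda>l. (Vk, Vp l))" by (auto simp: inj_def)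
    moreover have "(Vj, Vk) \<notin> (\<lambda>l. (Vj, Vr l)) ` UNIV" "(Vk, Vi) \<notin> (\<lambda>l. (Vk, Vp l)) ` UNIV"
      by auto
    ultimately show ?thesis
      unfolding out h using r a(1) ne
      by (cases v) (simp_all add: sum.reindex q p qr divide_simps, (simp add: algebra_simps)+)
  qed
  with pos show ?thesis
    by (simp add: perron_frobenius_vec_def)
qed

end

theory Submission
  imports Defs
begin

text \<open>
  The graph has no multiple edges, so a cell system is a function of triples of vertices, the unitary
  matrices in an equivalence are \<open>1 \<times> 1\<close>, and equivalence amounts to multiplying the value on every
  triangle by the product of phases attached to its three edges. In particular the moduli are
  invariants, and the classification splits into moduli and phases.

  Moduli. When the zigzag \<open>x1 \<rightarrow> x2 \<leftarrow> x3 \<rightarrow> x4 \<leftarrow> x1\<close> of a type II equation degenerates (\<open>x1 = x3\<close> or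
  \<open>x2 = x4\<close>), the equation involves only squared moduli. For the edge \<open>p_l \<rightarrow> q_l\<close>, together with
  the type I equation, it is a quadratic equation for \<open>|W(p_l, q_l, k)|\<^sup>2\<close>, whose two roots are the
  values of the two solutions (\<open>pqk_quadratic\<close>). The pair of edges \<open>p_l \<rightarrow> q_l\<close>,
  \<open>p_l \<rightarrow> q_(l-1)\<close> forces \<open>|W(p_l, q_(l-1), k)|\<^sup>2\<close> to be the other root, and the edge \<open>q_l \<rightarrow> k\<close>
  carries the choice of root from \<open>l\<close> to \<open>l + 1\<close>. So there is a single global sign, and the remaining
  moduli follow linearly from the type I equations (\<open>moduli\<close>). The two signs give different moduli,
  hence inequivalent solutions.

  Phases. For each \<open>l\<close> the eight triangles on the antipodal pairs \<open>{p_l, p_(l+1)}\<close>, \<open>{j, q_l}\<close>,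
  \<open>{k, r_(l+1)}\<close> form an octahedron. The nondegenerate type II equation for two of the pairs says
  that a sum of two terms, one for each vertex of the third pair, vanishes; if the moduli are known,
  this fixes the alternating product of the eight phases. These products are the only obstruction:
  once they agree for two systems with equal moduli, the edge phases can be solved for one triangle
  after the other, and the octahedra account exactly for the triangles \<open>p_(l+1), q_l, r_(l+1)\<close> at which no
  free edge is left (\<open>gauge_triangle\<close>). Hence equal moduli imply equivalence
  (\<open>same_moduli_equiv\<close>).

  That the two given functions are cell systems is a finite check (\<open>cell_system_E2_W\<close>); their values
  do not depend on \<open>l\<close>, so every equation reduces to a polynomial identity in \<open>[2]\<close>, \<open>sqrt 3\<close> and
  \<open>sqrt ([2][4])\<close>.
\<close>

section \<open>Cell systems on a graph without multiple edges\<close>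

locale simple_digraph =
  fixes G :: "('a::finite, 'a \<times> 'a) pre_digraph"
  assumes verts_G: "verts G = UNIV"
    and tail_G: "tail G = fst"
    and head_G: "head G = snd"
begin

abbreviation arc :: "'a \<Rightarrow> 'a \<Rightarrow> bool" where
  "arc x y \<equiv> (x, y) \<in> arcs G"

definition tri :: "'a \<Rightarrow> 'a \<Rightarrow> 'a \<Rightarrow> bool" where
  "tri x y z \<longleftrightarrow> arc x y \<and> arc y z \<and> arc z x"

text \<open>Extending the values by zero lets all sums run over the whole vertex type.\<close>

definition val :: "('a \<times> 'a \<Rightarrow> 'a \<times> 'a \<Rightarrow> 'a \<times> 'a \<Rightarrow> complex) \<Rightarrow> 'a \<Rightarrow> 'a \<Rightarrow> 'a \<Rightarrow> complex" where
  "val W x y z = (if tri x y z then W (x, y) (y, z) (z, x) else 0)"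

definition sq :: "('a \<times> 'a \<Rightarrow> 'a \<times> 'a \<Rightarrow> 'a \<times> 'a \<Rightarrow> complex) \<Rightarrow> 'a \<Rightarrow> 'a \<Rightarrow> 'a \<Rightarrow> real" where
  "sq W x y z = (cmod (val W x y z))\<^sup>2"

lemma val_zero: "\<not> tri x y z \<Longrightarrow> val W x y z = 0"
  by (simp add: val_def)

lemma triangle_pairs:
  "triangle G (x, y) b c \<longleftrightarrow> (\<exists>z. tri x y z \<and> b = (y, z) \<and> c = (z, x))"
  by (cases b; cases c) (auto simp: triangle_def tri_def head_G tail_G)

lemma arcs_between_eq: "arcs_between G x y = (if arc x y then {(x, y)} else {})"
  by (auto simp: arcs_between_def head_G tail_G)

lemma ball_arcs_between: "(\<forall>a\<in>arcs_between G x y. P a) \<longleftrightarrow> (arc x y \<longrightarrow> P (x, y))"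
  by (simp add: arcs_between_eq)

lemma rotation_iff:
  "(\<forall>a b c. triangle G a b c \<longrightarrow> W a b c = W b c a) \<longleftrightarrow> (\<forall>x y z. val W x y z = val W y z x)"
  by (auto simp: triangle_pairs val_def tri_def)

lemma cell_type_I_iff:
  "cell_type_I G \<phi> W \<longleftrightarrow>
     (\<forall>x y. arc x y \<longrightarrow> (\<Sum>z\<in>UNIV. sq W x y z) = qint 2 * \<phi> x * \<phi> y)"
proof -
  have "(\<Sum>(b, c)\<in>{(b, c). triangle G (x, y) b c}. W (x, y) b c * cnj (W (x, y) b c))
        = of_real (\<Sum>z\<in>UNIV. sq W x y z)" for x y
  proof -
    have S: "{(b, c). triangle G (x, y) b c} = (\<lambda>z. ((y, z), (z, x))) ` {z. tri x y z}"
      by (auto simp: triangle_pairs)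
    have inj: "inj_on (\<lambda>z. ((y, z), (z, x))) {z. tri x y z}"
      by (simp add: inj_on_def)
    have "(\<Sum>(b, c)\<in>{(b, c). triangle G (x, y) b c}. W (x, y) b c * cnj (W (x, y) b c))
        = (\<Sum>z | tri x y z. W (x, y) (y, z) (z, x) * cnj (W (x, y) (y, z) (z, x)))"
      unfolding S by (simp add: sum.reindex[OF inj])
    also have "\<dots> = (\<Sum>z\<in>UNIV. of_real (sq W x y z))"
      by (rule sum.mono_neutral_cong_left)
        (auto simp: val_def sq_def complex_norm_square simp del: of_real_power)
    finally show ?thesis
      by simp
  qed
  then show ?thesis
    unfolding cell_type_I_def verts_G by (simp only: ball_UNIV ball_arcs_between of_real_eq_iff simp_thms if_True) blast
qed

text \<open>The closed zigzag \<open>x1 \<rightarrow> x2 \<leftarrow> x3 \<rightarrow> x4 \<leftarrow> x1\<close>, coned off at all possible apexes \<open>k\<close>.\<close>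

definition zigzag :: "('a \<Rightarrow> real) \<Rightarrow> ('a \<times> 'a \<Rightarrow> 'a \<times> 'a \<Rightarrow> 'a \<times> 'a \<Rightarrow> complex) \<Rightarrow>
    'a \<Rightarrow> 'a \<Rightarrow> 'a \<Rightarrow> 'a \<Rightarrow> complex" where
  "zigzag \<phi> W x1 x2 x3 x4 = (\<Sum>k\<in>UNIV. of_real (inverse (\<phi> k)) * val W x1 x2 k * cnj (val W x3 x2 k)
     * val W x3 x4 k * cnj (val W x1 x4 k))"

lemma cell_type_II_zigzag:
  "cell_type_II G \<phi> W \<longleftrightarrow>
     (\<forall>x1 x2 x3 x4. arc x1 x2 \<longrightarrow> arc x3 x2 \<longrightarrow> arc x3 x4 \<longrightarrow> arc x1 x4 \<longrightarrow>
        zigzag \<phi> W x1 x2 x3 x4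
          = of_real ((if x2 = x4 then \<phi> x1 * \<phi> x2 * \<phi> x3 else 0)
                     + (if x1 = x3 then \<phi> x1 * \<phi> x2 * \<phi> x4 else 0)))"
proof -
  have sum_eq: "(\<Sum>(b1, b2, b3, b4)\<in>{(b1, b2, b3, b4).
              triangle G (x1, x2) b1 b2 \<and> triangle G (x3, x2) b1 b3 \<and>
              triangle G (x3, x4) b4 b3 \<and> triangle G (x1, x4) b4 b2}.
            of_real (inverse (\<phi> (head G b1))) *
              W (x1, x2) b1 b2 * cnj (W (x3, x2) b1 b3) * W (x3, x4) b4 b3 * cnj (W (x1, x4) b4 b2))
        = zigzag \<phi> W x1 x2 x3 x4" (is "sum ?f ?S = _") for x1 x2 x3 x4
  proof -
    let ?K = "{k. tri x1 x2 k \<and> tri x3 x2 k \<and> tri x3 x4 k \<and> tri x1 x4 k}"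
    let ?h = "\<lambda>k. ((x2, k), (k, x1), (k, x3), (x4, k))"
    have S: "?S = ?h ` ?K"
      by (auto simp: triangle_pairs)
    have inj: "inj_on ?h ?K"
      by (simp add: inj_on_def)
    have "sum ?f ?S = sum (?f \<circ> ?h) ?K"
      unfolding S by (rule sum.reindex[OF inj])
    also have "\<dots> = zigzag \<phi> W x1 x2 x3 x4"
      unfolding zigzag_def
    proof (rule sum.mono_neutral_cong_left)
      show "\<forall>k\<in>UNIV - ?K. of_real (inverse (\<phi> k)) * val W x1 x2 k * cnj (val W x3 x2 k)
          * val W x3 x4 k * cnj (val W x1 x4 k) = 0"
      proof
        fix k assume "k \<in> UNIV - ?K"
        then have "\<not> tri x1 x2 k \<or> \<not> tri x3 x2 k \<or> \<not> tri x3 x4 k \<or> \<not> tri x1 x4 k"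
          by blast
        then show "of_real (inverse (\<phi> k)) * val W x1 x2 k * cnj (val W x3 x2 k)
          * val W x3 x4 k * cnj (val W x1 x4 k) = 0"
          by (elim disjE) (simp_all add: val_zero)
      qed
      show "(?f \<circ> ?h) k = of_real (inverse (\<phi> k)) * val W x1 x2 k * cnj (val W x3 x2 k)
          * val W x3 x4 k * cnj (val W x1 x4 k)" if "k \<in> ?K" for k
        using that by (simp only: mem_Collect_eq o_def prod.case val_def if_True head_G snd_conv)
    qed simp_all
    finally show ?thesis .
  qed
  have c1: "(x1, x2) = (x1, x4) \<and> (x3, x2) = (x3, x4) \<longleftrightarrow> x2 = x4"
    and c2: "(x1, x2) = (x3, x2) \<and> (x3, x4) = (x1, x4) \<longleftrightarrow> x1 = x3" for x1 x2 x3 x4 :: 'a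
    by blast+
  show ?thesis
    unfolding cell_type_II_def verts_G ball_UNIV ball_arcs_between sum_eq c1 c2 of_real_add
      if_distrib[of complex_of_real] of_real_0 ..
qed

text \<open>Degenerate zigzags involve only the moduli; only the nondegenerate ones see the phases.\<close>

lemma zigzag_row: "zigzag \<phi> W x y x z = of_real (\<Sum>k\<in>UNIV. sq W x y k * sq W x z k / \<phi> k)"
  unfolding zigzag_def of_real_sum
  by (rule sum.cong) (simp_all add: sq_def complex_norm_square divide_inverse mult_ac
        del: of_real_power)

lemma zigzag_column: "zigzag \<phi> W x y z y = of_real (\<Sum>k\<in>UNIV. sq W x y k * sq W z y k / \<phi> k)"
  unfolding zigzag_def of_real_sum
  by (rule sum.cong) (simp_all add: sq_def complex_norm_square divide_inverse mult_ac
        del: of_real_power)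

text \<open>The three conjuncts are the zigzags with \<open>x1 = x3\<close> (this includes the case of a single edge),
  those with \<open>x2 = x4\<close> only, and the nondegenerate ones. Their right-hand sides differ because the
  two Kronecker deltas of a type II equation test exactly these coincidences.\<close>

lemma cell_type_II_iff:
  "cell_type_II G \<phi> W \<longleftrightarrow>
     (\<forall>x y z. arc x y \<longrightarrow> arc x z \<longrightarrow> (\<Sum>k\<in>UNIV. sq W x y k * sq W x z k / \<phi> k)
         = (if y = z then \<phi> x * \<phi> x * \<phi> y else 0) + \<phi> x * \<phi> y * \<phi> z) \<and>
     (\<forall>x y z. arc x y \<longrightarrow> arc z y \<longrightarrow> x \<noteq> z \<longrightarrow>
         (\<Sum>k\<in>UNIV. sq W x y k * sq W z y k / \<phi> k) = \<phi> x * \<phi> y * \<phi> z) \<and>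
     (\<forall>x1 x2 x3 x4. arc x1 x2 \<longrightarrow> arc x3 x2 \<longrightarrow> arc x3 x4 \<longrightarrow> arc x1 x4 \<longrightarrow> x1 \<noteq> x3 \<longrightarrow> x2 \<noteq> x4 \<longrightarrow>
         zigzag \<phi> W x1 x2 x3 x4 = 0)"
  (is "_ \<longleftrightarrow> ?row \<and> ?col \<and> ?oct")
proof
  assume "cell_type_II G \<phi> W"
  then have *: "zigzag \<phi> W x1 x2 x3 x4
          = of_real ((if x2 = x4 then \<phi> x1 * \<phi> x2 * \<phi> x3 else 0)
                     + (if x1 = x3 then \<phi> x1 * \<phi> x2 * \<phi> x4 else 0))"
    if "arc x1 x2" "arc x3 x2" "arc x3 x4" "arc x1 x4" for x1 x2 x3 x4
    using that by (auto simp: cell_type_II_zigzag)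
  have ?row
  proof (intro allI impI)
    fix x y z assume "arc x y" "arc x z"
    from *[OF this(1) this this(2)] show "(\<Sum>k\<in>UNIV. sq W x y k * sq W x z k / \<phi> k)
         = (if y = z then \<phi> x * \<phi> x * \<phi> y else 0) + \<phi> x * \<phi> y * \<phi> z"
      unfolding zigzag_row of_real_eq_iff by (simp add: mult_ac split: if_splits)
  qed
  moreover have ?col
  proof (intro allI impI)
    fix x y z assume "arc x y" "arc z y" "x \<noteq> z"
    with *[OF this(1,2,2,1)] show "(\<Sum>k\<in>UNIV. sq W x y k * sq W z y k / \<phi> k) = \<phi> x * \<phi> y * \<phi> z"
      unfolding zigzag_column of_real_eq_iff by simp
  qed
  moreover have ?oct
    using * by auto
  ultimately show "?row \<and> ?col \<and> ?oct"
    by blast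
next
  assume r: "?row \<and> ?col \<and> ?oct"
  show "cell_type_II G \<phi> W"
    unfolding cell_type_II_zigzag
  proof (intro allI impI)
    fix x1 x2 x3 x4
    assume a: "arc x1 x2" "arc x3 x2" "arc x3 x4" "arc x1 x4"
    show "zigzag \<phi> W x1 x2 x3 x4
          = of_real ((if x2 = x4 then \<phi> x1 * \<phi> x2 * \<phi> x3 else 0)
                     + (if x1 = x3 then \<phi> x1 * \<phi> x2 * \<phi> x4 else 0))"
    proof (cases "x1 = x3")
      case True
      have "(\<Sum>k\<in>UNIV. sq W x1 x2 k * sq W x1 x4 k / \<phi> k)
         = (if x2 = x4 then \<phi> x1 * \<phi> x1 * \<phi> x2 else 0) + \<phi> x1 * \<phi> x2 * \<phi> x4"
        using r a(1,4) by blast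
      then show ?thesis
        unfolding True[symmetric] zigzag_row of_real_eq_iff by (simp only: mult_ac simp_thms if_True)
    next
      case x13: False
      show ?thesis
      proof (cases "x2 = x4")
        case True
        have "(\<Sum>k\<in>UNIV. sq W x1 x2 k * sq W x3 x2 k / \<phi> k) = \<phi> x1 * \<phi> x2 * \<phi> x3"
          using r a(1,2) x13 by blast
        with x13 show ?thesis
          unfolding True[symmetric] zigzag_column of_real_eq_iff by simp
      next
        case False
        then have "zigzag \<phi> W x1 x2 x3 x4 = 0"
          using r a x13 by blast
        with x13 False show ?thesis
          by simp
      qed
    qed
  qed
qed

text \<open>Each unitary matrix has size one here, so it is a phase attached to an arc.\<close>

lemma cell_equiv_gaugeI:
  assumes u: "\<And>x y. arc x y \<Longrightarrow> cmod (u x y) = 1"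
    and W: "\<And>x y z. tri x y z \<Longrightarrow> val W1 x y z = u x y * u y z * u z x * val W2 x y z"
  shows "cell_equiv G W1 W2"
  unfolding cell_equiv_def
proof (intro exI[of _ "\<lambda>x y _ _. u x y"] conjI ballI)
  fix x y
  have "u x y * cnj (u x y) = 1" if "arc x y"
    using u[OF that] by (simp add: complex_norm_square[symmetric])
  then show "unitary_on (arcs_between G x y) (\<lambda>_ _. u x y)"
    by (auto simp: unitary_on_def arcs_between_eq mult.commute)
next
  fix x y z a b c
  assume "a \<in> arcs_between G x y" "b \<in> arcs_between G y z" "c \<in> arcs_between G z x"
  then have "arc x y" "arc y z" "arc z x" "a = (x, y)" "b = (y, z)" "c = (z, x)"
    by (auto simp: arcs_between_eq split: if_splits)
  then show "W1 a b c =
             (\<Sum>a'\<in>arcs_between G x y. \<Sum>b'\<in>arcs_between G y z. \<Sum>c'\<in>arcs_between G z x.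
                u x y * u y z * u z x * W2 a' b' c')"
    using W[of x y z] by (simp add: arcs_between_eq val_def tri_def)
qed

lemma cell_equiv_cmod:
  assumes "cell_equiv G W1 W2"
  shows "cmod (val W1 x y z) = cmod (val W2 x y z)"
proof (cases "tri x y z")
  case True
  then have arcs: "arc x y" "arc y z" "arc z x"
    by (simp_all add: tri_def)
  from assms obtain u where
    u: "\<forall>x\<in>verts G. \<forall>y\<in>verts G. unitary_on (arcs_between G x y) (u x y)"
    and W: "\<forall>x\<in>verts G. \<forall>y\<in>verts G. \<forall>z\<in>verts G.
         \<forall>a\<in>arcs_between G x y. \<forall>b\<in>arcs_between G y z. \<forall>c\<in>arcs_between G z x.
           W1 a b c = (\<Sum>a'\<in>arcs_between G x y. \<Sum>b'\<in>arcs_between G y z. \<Sum>c'\<in>arcs_between G z x.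
              u x y a a' * u y z b b' * u z x c c' * W2 a' b' c')"
    unfolding cell_equiv_def by (elim exE conjE) (rule that)
  have "W1 (x, y) (y, z) (z, x) = u x y (x, y) (x, y) * u y z (y, z) (y, z)
      * u z x (z, x) (z, x) * W2 (x, y) (y, z) (z, x)"
    using W[unfolded ball_arcs_between verts_G ball_UNIV, rule_format, OF arcs] arcs
    by (simp add: arcs_between_eq)
  note W = this
  have "cmod (u v w (v, w) (v, w)) = 1" if "arc v w" for v w
  proof -
    have "u v w (v, w) (v, w) * cnj (u v w (v, w) (v, w)) = 1"
      using u[unfolded verts_G ball_UNIV, rule_format, of v w] that by (simp add: unitary_on_def arcs_between_eq)
    then have "of_real ((cmod (u v w (v, w) (v, w)))\<^sup>2) = (1 :: complex)"
      by (simp only: complex_norm_square)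
    then have "(cmod (u v w (v, w) (v, w)))\<^sup>2 = 1"
      by (simp only: of_real_eq_1_iff)
    then show ?thesis
      by (simp add: power2_eq_1_iff) (smt (verit) norm_ge_zero)
  qed
  then show ?thesis
    using W arcs True by (simp add: val_def norm_mult)
qed (simp add: val_def)

end

section \<open>Vertices, arcs and triangles of the graph\<close>

lemma mod3_cases: "(m::3) = l \<or> m = l + 1 \<or> m = l - 1"
proof -
  have zero_one_two: "x = 0 \<or> x = 1 \<or> x = 2" for x :: 3
  proof (cases x)
    case (of_int z)
    then have "z = 0 \<or> z = 1 \<or> z = 2" by auto
    with of_int show ?thesis by auto
  qed
  show ?thesis
    using zero_one_two[of m] zero_one_two[of l] by auto
qed

lemma mod3_simps [simp]:
  fixes l :: 3
  shows "l + 1 \<noteq> l" "l \<noteq> l + 1" "l - 1 \<noteq> l" "l \<noteq> l - 1" "l + 1 \<noteq> l - 1" "l - 1 \<noteq> l + 1"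
    "l + 1 + 1 = l - 1" "l - 1 - 1 = l + 1" "l + 2 = l - 1" "l - 2 = l + 1"
proof -
  show "l + 1 + 1 = l - 1" by (simp add: algebra_simps)
qed (simp_all add: algebra_simps)

instance E2_vertex :: finite
proof
  have "(UNIV :: E2_vertex set) = {Vi, Vj, Vk} \<union> range Vp \<union> range Vq \<union> range Vr"
    by (auto, metis E2_vertex.exhaust rangeI)
  then show "finite (UNIV :: E2_vertex set)"
    by (metis finite.emptyI finite.insertI finite_UnI finite_imageI finite)
qed

text \<open>Expanding around a chosen base point \<open>l\<close> keeps the cyclic symmetry: the neighbours of a vertex
  with index \<open>l\<close> have index \<open>l\<close>, \<open>l + 1\<close> or \<open>l - 1\<close>, so no case split into three concrete
  residues is needed.\<close>

lemma sum_mod3: "(\<Sum>m\<in>UNIV. f m) = f l + f (l + 1) + f (l - 1)" for l :: 3 and f :: "3 \<Rightarrow> 'b::comm_monoid_add"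
proof -
  have "(UNIV :: 3 set) = {l, l + 1, l - 1}"
    using mod3_cases[of _ l] by auto
  then have "sum f UNIV = sum f {l, l + 1, l - 1}" by (rule arg_cong)
  then show ?thesis
    by (simp add: add.assoc)
qed

lemma sum_vertices: "(\<Sum>v\<in>UNIV. f v) = f Vi + f Vj + f Vk + (\<Sum>l\<in>UNIV. f (Vp l))
     + (\<Sum>l\<in>UNIV. f (Vq l)) + (\<Sum>l\<in>UNIV. f (Vr l))" for f :: "E2_vertex \<Rightarrow> 'b::comm_monoid_add"
proof -
  have *: "(UNIV :: E2_vertex set) = {Vi, Vj, Vk} \<union> (range Vp \<union> (range Vq \<union> range Vr))"
    by (auto, metis E2_vertex.exhaust rangeI)
  have "sum f UNIV = sum f {Vi, Vj, Vk} + (sum f (range Vp) + (sum f (range Vq) + sum f (range Vr)))"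
    unfolding * by (subst sum.union_disjoint; (auto)?)+
  then show ?thesis
    by (simp add: sum.reindex inj_def add.assoc)
qed

interpretation E2: simple_digraph E2_12
  by unfold_locales (simp_all add: E2_12_def)

lemma arc_from:
  "E2.arc Vi y \<longleftrightarrow> y = Vj"
  "E2.arc Vj y \<longleftrightarrow> y = Vk \<or> (\<exists>l. y = Vr l)"
  "E2.arc Vk y \<longleftrightarrow> y = Vi \<or> (\<exists>l. y = Vp l)"
  "E2.arc (Vp l) y \<longleftrightarrow> y = Vj \<or> y = Vq l \<or> y = Vq (l - 1)"
  "E2.arc (Vq l) y \<longleftrightarrow> y = Vk \<or> y = Vr (l + 1)"
  "E2.arc (Vr l) y \<longleftrightarrow> y = Vp l \<or> y = Vp (l - 1)"
  by (auto simp: E2_12_def) (metis diff_add_cancel)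

lemma arc_to:
  "E2.arc x Vi \<longleftrightarrow> x = Vk"
  "E2.arc x Vj \<longleftrightarrow> x = Vi \<or> (\<exists>l. x = Vp l)"
  "E2.arc x Vk \<longleftrightarrow> x = Vj \<or> (\<exists>l. x = Vq l)"
  "E2.arc x (Vp l) \<longleftrightarrow> x = Vk \<or> x = Vr l \<or> x = Vr (l + 1)"
  "E2.arc x (Vq l) \<longleftrightarrow> x = Vp l \<or> x = Vp (l + 1)"
  "E2.arc x (Vr l) \<longleftrightarrow> x = Vj \<or> x = Vq (l - 1)"
  by (auto simp: E2_12_def)

text \<open>Induction over the triangles up to rotation. A triangle starting at \<open>p_l\<close> closes through
  \<open>k\<close>, \<open>r_l\<close> or \<open>r_(l+1)\<close>, and primed cases are those that use \<open>q_(l-1)\<close> or \<open>r_l\<close>.\<close>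

lemma tri_cases [consumes 1, case_names rotate ijk pjk pjr pjr' pqk pqk' pqr pqr']:
  assumes "E2.tri x y z"
    and rot: "\<And>x y z. P x y z \<Longrightarrow> P y z x"
    and "P Vi Vj Vk"
    and "\<And>l. P (Vp l) Vj Vk"
    and "\<And>l. P (Vp l) Vj (Vr (l + 1))" "\<And>l. P (Vp l) Vj (Vr l)"
    and "\<And>l. P (Vp l) (Vq l) Vk" "\<And>l. P (Vp l) (Vq (l - 1)) Vk"
    and "\<And>l. P (Vp l) (Vq l) (Vr (l + 1))" "\<And>l. P (Vp l) (Vq (l - 1)) (Vr l)"
  shows "P x y z"
proof -
  have base: "P x y z" if "E2.tri x y z" "E2_base x" for x y z
    using that assms(3-) assms(5)[of "l - 1" for l] assms(9)[of "l - 1" for l]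
    by (cases x) (auto simp: E2.tri_def arc_from)
  have "E2_base x \<or> E2_base y \<or> E2_base z"
    using assms(1) by (cases x; cases y) (auto simp: E2.tri_def arc_from)
  moreover have "E2.tri y z x" "E2.tri z x y"
    using assms(1) by (auto simp: E2.tri_def)
  ultimately show ?thesis
    using base assms(1) rot by metis
qed

section \<open>The numbers in the two solutions\<close>

text \<open>All squared moduli and eigenvector entries lie in the field generated by \<open>q2 = [2]\<close>, \<open>rt3\<close> and \<open>disc = sqrt ([2][4])\<close>, with the
  relations \<open>q2\<^sup>2 = 2 + rt3\<close>, \<open>rt3\<^sup>2 = 3\<close> and \<open>disc\<^sup>2 = 3 + 2 rt3\<close>. Rewriting with these relations
  brings polynomials to a normal form.\<close>

abbreviation (input) q2 where "q2 \<equiv> qint 2"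
abbreviation (input) rt3 :: real where "rt3 \<equiv> sqrt 3"
definition disc :: real where "disc = sqrt (3 + 2 * rt3)"

lemma weight_relations:
  "q2 * q2 = 2 + rt3" "rt3 * rt3 = 3" "disc * disc = 3 + 2 * rt3" "q2 > 0" "rt3 > 1" "disc > 0" "disc < 2 + rt3"
proof -
  show rt3: "rt3 * rt3 = 3" "rt3 > 1" by simp_all
  show "q2 * q2 = 2 + rt3" "q2 > 0"
    using qint_2_sq qint_2_pos by (simp_all add: power2_eq_square)
  show disc: "disc * disc = 3 + 2 * rt3" "disc > 0"
    using rt3 by (simp_all add: disc_def add_pos_nonneg)
  show "disc < 2 + rt3"
    unfolding disc_def using rt3 by (intro real_less_lsqrt) (auto simp: power2_eq_square algebra_simps add_pos_nonneg)
qed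

lemma phi_values:
  "E2_phi Vi = 1" "E2_phi Vj = 1 + rt3" "E2_phi Vk = 1 + rt3" "E2_phi (Vp l) = (3 + 2 * rt3) / 3"
  "E2_phi (Vq l) = (3 + rt3) / 3" "E2_phi (Vr l) = (3 + rt3) / 3"
proof -
  note w = weight_relations
  show "E2_phi Vi = 1"
    by simp
  show "E2_phi Vj = 1 + rt3" "E2_phi Vk = 1 + rt3"
    by (simp_all add: qint_3)
  have "q2 ^ 3 / (q2 * rt3) = (q2 * q2) / rt3"
    using w by (simp add: power3_eq_cube)
  also have "\<dots> = (3 + 2 * rt3) / 3"
    using w(1,2,5) by (simp add: field_simps)
  finally show "E2_phi (Vp l) = (3 + 2 * rt3) / 3"
    by (simp add: qint_4)
  have "q2 * (1 + rt3) / (q2 * rt3) = (3 + rt3) / 3"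
    using w(2,4,5) by (simp add: field_simps)
  then show "E2_phi (Vq l) = (3 + rt3) / 3" "E2_phi (Vr l) = (3 + rt3) / 3"
    by (simp_all add: qint_3 qint_4)
qed

text \<open>Denominators are cleared with \<open>rt3\<^sup>2 = 3\<close>, so that the type II equations, which divide by
  \<open>E2_phi\<close>, become polynomial identities.\<close>

lemma inverse_phi:
  "inverse (E2_phi Vi) = 1" "inverse (E2_phi Vj) = (rt3 - 1) / 2" "inverse (E2_phi Vk) = (rt3 - 1) / 2"
  "inverse (E2_phi (Vp l)) = 2 * rt3 - 3"
  "inverse (E2_phi (Vq l)) = (3 - rt3) / 2" "inverse (E2_phi (Vr l)) = (3 - rt3) / 2"
proof -
  have "(1 + rt3) * ((rt3 - 1) / 2) = 1" "(3 + 2 * rt3) / 3 * (2 * rt3 - 3) = 1" "(3 + rt3) / 3 * ((3 - rt3) / 2) = 1"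
    using weight_relations(2) by (simp_all add: field_simps)
  then have "inverse (1 + rt3) = (rt3 - 1) / 2" "inverse ((3 + 2 * rt3) / 3) = 2 * rt3 - 3"
    "inverse ((3 + rt3) / 3) = (3 - rt3) / 2"
    by (metis inverse_unique)+
  then show "inverse (E2_phi Vi) = 1" "inverse (E2_phi Vj) = (rt3 - 1) / 2" "inverse (E2_phi Vk) = (rt3 - 1) / 2"
    "inverse (E2_phi (Vp l)) = 2 * rt3 - 3"
    "inverse (E2_phi (Vq l)) = (3 - rt3) / 2" "inverse (E2_phi (Vr l)) = (3 - rt3) / 2"
    unfolding phi_values by simp_all
qed

declare E2_phi.simps [simp del]

text \<open>Up to sign the values of the solution with sign \<open>\<epsilon>\<close>. The values on \<open>p_l, q_l, k\<close> and on
  \<open>p_l, j, r_(l+1)\<close> are both \<open>w_pqk \<epsilon>\<close>; replacing \<open>l\<close> by \<open>l - 1\<close> in the second or third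
  vertex changes \<open>\<epsilon>\<close> to \<open>- \<epsilon>\<close>.\<close>

definition w_ijk :: real where "w_ijk = sqrt (qint 2 * qint 3)"
definition w_pjk :: real where "w_pjk = qint 2 * sqrt (qint 3) / sqrt (qint 4)"
definition w_pqk :: "real \<Rightarrow> real" where
  "w_pqk \<epsilon> = sqrt (qint 2) ^ 3 / qint 4 * sqrt (qint 2 * qint 4 + \<epsilon> * sqrt (qint 2 * qint 4))"
definition w_pqr :: "real \<Rightarrow> real" where
  "w_pqr \<epsilon> = sqrt (qint 2) ^ 3 / qint 4 * sqrt (qint 2 ^ 2 + \<epsilon> * sqrt (qint 2 * qint 4))"

lemma w_squares:
  "w_ijk * w_ijk = q2 * (1 + rt3)"
  "w_pjk * w_pjk = q2 * (3 + rt3) / 3"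
  "\<epsilon> \<in> {1, -1} \<Longrightarrow> w_pqk \<epsilon> * w_pqk \<epsilon> = q2 * (3 + 2 * rt3 + \<epsilon> * disc) / 3"
  "\<epsilon> \<in> {1, -1} \<Longrightarrow> w_pqr \<epsilon> * w_pqr \<epsilon> = q2 * (2 + rt3 + \<epsilon> * disc) / 3"
  "w_pqr 1 * w_pqr (-1) = q2 * (1 + rt3) / 3"
proof -
  note w = weight_relations
  show "w_ijk * w_ijk = q2 * (1 + rt3)"
    using w by (simp add: w_ijk_def qint_3)
  have "w_pjk * w_pjk = (q2 * q2) * (1 + rt3) / qint 4"
  proof -
    have "sqrt (1 + rt3) * sqrt (1 + rt3) = 1 + rt3" "sqrt (qint 4) * sqrt (qint 4) = qint 4"
      using w by (simp_all add: qint_4)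
    then show ?thesis
      by (simp add: w_pjk_def qint_3 mult_ac)
  qed
  also have "\<dots> = q2 * ((1 + rt3) / rt3)"
    using w(4) by (simp add: qint_4)
  also have "(1 + rt3) / rt3 = (3 + rt3) / 3"
    using w(2,5) by (simp add: field_simps)
  finally show "w_pjk * w_pjk = q2 * (3 + rt3) / 3"
    by simp
  have pre: "(sqrt q2 ^ 3 / qint 4) * (sqrt q2 ^ 3 / qint 4) = q2 / 3"
  proof -
    have "sqrt q2 ^ 3 * sqrt q2 ^ 3 = (sqrt q2 * sqrt q2) ^ 3"
      by (simp only: power_mult_distrib)
    then have "sqrt q2 ^ 3 * sqrt q2 ^ 3 = q2 ^ 3"
      using w by simp
    then show ?thesis
      using w by (simp add: qint_4 field_simps power3_eq_cube)
  qed
  have q24: "qint 2 * qint 4 = 3 + 2 * rt3"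
    unfolding qint_4 using w(1,2) by algebra
  have disc: "sqrt (qint 2 * qint 4) = disc"
    unfolding q24 disc_def ..
  have sqrt2: "c * sqrt x * (c * sqrt y) = c * c * sqrt (x * y)" for c x y :: real
    by (simp add: real_sqrt_mult mult_ac)
  have q22: "qint 2 ^ 2 = 2 + rt3"
    by (rule qint_2_sq)
  show "w_pqk \<epsilon> * w_pqk \<epsilon> = q2 * (3 + 2 * rt3 + \<epsilon> * disc) / 3" if "\<epsilon> \<in> {1, -1}"
  proof -
    have "\<epsilon> * disc = disc \<or> \<epsilon> * disc = - disc" using that by auto
    with w(5-7) have "3 + 2 * rt3 + \<epsilon> * disc \<ge> 0" by linarith
    then show ?thesis
      unfolding w_pqk_def sqrt2 pre disc unfolding q24 by simp
  qed
  show "w_pqr \<epsilon> * w_pqr \<epsilon> = q2 * (2 + rt3 + \<epsilon> * disc) / 3" if "\<epsilon> \<in> {1, -1}"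
  proof -
    have "\<epsilon> * disc = disc \<or> \<epsilon> * disc = - disc" using that by auto
    with w(5-7) have "2 + rt3 + \<epsilon> * disc \<ge> 0" by linarith
    then show ?thesis
      unfolding w_pqr_def sqrt2 pre disc unfolding q22 by simp
  qed
  have "(2 + rt3 + disc) * (2 + rt3 - disc) = (1 + rt3) * (1 + rt3)"
    using w(2,3) by (simp add: algebra_simps)
  then show "w_pqr 1 * w_pqr (-1) = q2 * (1 + rt3) / 3"
    unfolding w_pqr_def sqrt2 pre disc unfolding q22 using w by simp
qed

section \<open>Both functions are cell systems\<close>

lemma tri_base:
  "E2.tri x y z \<Longrightarrow> E2_base x \<and> \<not> E2_base y \<and> \<not> E2_base z \<or>
     \<not> E2_base x \<and> E2_base y \<and> \<not> E2_base z \<or> \<not> E2_base x \<and> \<not> E2_base y \<and> E2_base z"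
  by (induction x y z rule: tri_cases) auto

lemma E2_W_rotate: "E2.val (E2_W \<epsilon>) x y z = E2.val (E2_W \<epsilon>) y z x"
proof (cases "E2.tri x y z")
  case True
  then have "E2.tri y z x"
    by (simp add: E2.tri_def)
  then show ?thesis
    using True tri_base[OF True] by (auto simp: E2.val_def E2_W_def E2.tail_G)
next
  case False
  then have "\<not> E2.tri y z x"
    by (auto simp: E2.tri_def)
  with False show ?thesis
    by (simp add: E2.val_def)
qed

lemma E2_W_values:
  "E2.val (E2_W \<epsilon>) Vi Vj Vk = of_real w_ijk"
  "E2.val (E2_W \<epsilon>) (Vp l) Vj Vk = of_real w_pjk"
  "E2.val (E2_W \<epsilon>) (Vp l) (Vq m) Vk = of_real (if m = l then w_pqk \<epsilon> else if m = l - 1 then w_pqk (- \<epsilon>) else 0)"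
  "E2.val (E2_W \<epsilon>) (Vp l) Vj (Vr n) = of_real (if n = l + 1 then w_pqk \<epsilon> else if n = l then w_pqk (- \<epsilon>) else 0)"
  "E2.val (E2_W \<epsilon>) (Vp l) (Vq m) (Vr n) = of_real (if m = l - 1 \<and> n = l then w_pqr \<epsilon>
     else if m = l \<and> n = l + 1 then - w_pqr (- \<epsilon>) else 0)"
  by (auto simp: E2.val_def E2.tri_def arc_from E2_W_def E2.tail_G Let_def w_ijk_def w_pjk_def w_pqk_def w_pqr_def)

text \<open>Rotating \<open>i\<close> or \<open>p_l\<close> to the front, as directed rewrite rules: the rotation law itself would
  make the simplifier loop.\<close>

lemma val_rotations:
  assumes rot: "\<And>x y z. E2.val W x y z = E2.val W y z x"
  shows "E2.val W Vj Vk Vi = E2.val W Vi Vj Vk" "E2.val W Vk Vi y = E2.val W Vi y Vk"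
    "E2.val W Vj z (Vp l) = E2.val W (Vp l) Vj z" "E2.val W (Vq m) z (Vp l) = E2.val W (Vp l) (Vq m) z"
    "E2.val W Vk (Vp l) y = E2.val W (Vp l) y Vk" "E2.val W (Vr n) (Vp l) y = E2.val W (Vp l) y (Vr n)"
  using rot by metis+

lemma sq_rotations:
  assumes rot: "\<And>x y z. E2.val W x y z = E2.val W y z x"
  shows "E2.sq W Vj Vk Vi = E2.sq W Vi Vj Vk" "E2.sq W Vk Vi y = E2.sq W Vi y Vk"
    "E2.sq W Vj z (Vp l) = E2.sq W (Vp l) Vj z" "E2.sq W (Vq m) z (Vp l) = E2.sq W (Vp l) (Vq m) z"
    "E2.sq W Vk (Vp l) y = E2.sq W (Vp l) y Vk" "E2.sq W (Vr n) (Vp l) y = E2.sq W (Vp l) y (Vr n)"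
  unfolding E2.sq_def by (simp_all only: val_rotations[OF rot])

lemma sq_zero: "\<not> E2.tri x y z \<Longrightarrow> E2.sq W x y z = 0"
  by (simp add: E2.sq_def E2.val_zero)

definition sq_pqk :: "real \<Rightarrow> real" where "sq_pqk \<epsilon> = q2 * (3 + 2 * rt3 + \<epsilon> * disc) / 3"
definition sq_pqr :: "real \<Rightarrow> real" where "sq_pqr \<epsilon> = q2 * (2 + rt3 + \<epsilon> * disc) / 3"

lemma E2_W_sq:
  assumes "\<epsilon> \<in> {1, -1}"
  shows "E2.sq (E2_W \<epsilon>) Vi Vj Vk = q2 * (1 + rt3)"
  "E2.sq (E2_W \<epsilon>) (Vp l) Vj Vk = q2 * (3 + rt3) / 3"
  "E2.sq (E2_W \<epsilon>) (Vp l) (Vq m) Vk = (if m = l then sq_pqk \<epsilon> else if m = l - 1 then sq_pqk (- \<epsilon>) else 0)"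
  "E2.sq (E2_W \<epsilon>) (Vp l) Vj (Vr n) = (if n = l + 1 then sq_pqk \<epsilon> else if n = l then sq_pqk (- \<epsilon>) else 0)"
  "E2.sq (E2_W \<epsilon>) (Vp l) (Vq m) (Vr n) = (if m = l - 1 \<and> n = l then sq_pqr \<epsilon>
     else if m = l \<and> n = l + 1 then sq_pqr (- \<epsilon>) else 0)"
proof -
  have "- \<epsilon> \<in> {1, -1}" using assms by auto
  note sqs = w_squares(1,2) w_squares(3,4)[OF assms] w_squares(3,4)[OF this]
  show "E2.sq (E2_W \<epsilon>) Vi Vj Vk = q2 * (1 + rt3)"
  "E2.sq (E2_W \<epsilon>) (Vp l) Vj Vk = q2 * (3 + rt3) / 3"
  "E2.sq (E2_W \<epsilon>) (Vp l) (Vq m) Vk = (if m = l then sq_pqk \<epsilon> else if m = l - 1 then sq_pqk (- \<epsilon>) else 0)"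
  "E2.sq (E2_W \<epsilon>) (Vp l) Vj (Vr n) = (if n = l + 1 then sq_pqk \<epsilon> else if n = l then sq_pqk (- \<epsilon>) else 0)"
  "E2.sq (E2_W \<epsilon>) (Vp l) (Vq m) (Vr n) = (if m = l - 1 \<and> n = l then sq_pqr \<epsilon>
     else if m = l \<and> n = l + 1 then sq_pqr (- \<epsilon>) else 0)"
    unfolding E2.sq_def E2_W_values norm_of_real power2_abs power2_eq_square sq_pqk_def sq_pqr_def
    using sqs by (simp_all del: minus_mult_minus)
qed

lemma weight_reduce:
  "q2 * q2 = 2 + rt3" "q2 * (q2 * x) = (2 + rt3) * x" "rt3 * rt3 = 3" "rt3 * (rt3 * x) = 3 * x"
  using weight_relations(1,2) by (simp_all flip: mult.assoc)

text \<open>Naming the product \<open>\<epsilon> * disc\<close> treats both signs at once, since its square is the same for both.\<close>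

context
  fixes \<epsilon> e :: real
  assumes \<epsilon>: "\<epsilon> \<in> {1, -1}" and e: "e = \<epsilon> * disc"
begin

lemma e_square: "e * e = 3 + 2 * rt3" "e * (e * x) = (3 + 2 * rt3) * x"
proof -
  show "e * e = 3 + 2 * rt3"
    using \<epsilon> weight_relations(3) by (auto simp: e)
  then show "e * (e * x) = (3 + 2 * rt3) * x"
    by (simp flip: mult.assoc)
qed

lemma sq_values:
  "sq_pqk \<epsilon> = q2 * (3 + 2 * rt3 + e) / 3" "sq_pqk (- \<epsilon>) = q2 * (3 + 2 * rt3 - e) / 3"
  "sq_pqr \<epsilon> = q2 * (2 + rt3 + e) / 3" "sq_pqr (- \<epsilon>) = q2 * (2 + rt3 - e) / 3"
  by (simp_all add: sq_pqk_def sq_pqr_def e)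

lemmas evaluate = sum_vertices sq_rotations[OF E2_W_rotate] E2_W_sq[OF \<epsilon>] sq_zero E2.tri_def
  arc_from

definition edge_cond :: "E2_vertex \<Rightarrow> E2_vertex \<Rightarrow> bool" where
  "edge_cond x y \<longleftrightarrow> (\<Sum>z\<in>UNIV. E2.sq (E2_W \<epsilon>) x y z) = qint 2 * E2_phi x * E2_phi y"

definition row_cond :: "E2_vertex \<Rightarrow> E2_vertex \<Rightarrow> E2_vertex \<Rightarrow> bool" where
  "row_cond x y z \<longleftrightarrow> (\<Sum>k\<in>UNIV. E2.sq (E2_W \<epsilon>) x y k * E2.sq (E2_W \<epsilon>) x z k / E2_phi k)
     = (if y = z then E2_phi x * E2_phi x * E2_phi y else 0) + E2_phi x * E2_phi y * E2_phi z"

definition column_cond :: "E2_vertex \<Rightarrow> E2_vertex \<Rightarrow> E2_vertex \<Rightarrow> bool" where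
  "column_cond x y z \<longleftrightarrow> (\<Sum>k\<in>UNIV. E2.sq (E2_W \<epsilon>) x y k * E2.sq (E2_W \<epsilon>) z y k / E2_phi k)
     = E2_phi x * E2_phi y * E2_phi z"

lemma row_cond_sym: "row_cond x y z \<Longrightarrow> row_cond x z y"
  by (simp add: row_cond_def mult_ac split: if_splits)

lemma column_cond_sym: "column_cond x y z \<Longrightarrow> column_cond z y x"
  by (simp add: column_cond_def mult_ac)

text \<open>In the following three lists the first rewriting evaluates the sum over the third vertex and
  leaves the squared moduli symbolic; in the last two it must also replace \<open>inverse (E2_phi x)\<close>
  before \<open>E2_phi x\<close> itself is unfolded. The rest is the normal form of polynomials.\<close>

lemma edge_conds:
  "edge_cond Vi Vj"
  "edge_cond Vj Vk"
  "edge_cond Vj (Vr l)"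
  "edge_cond Vk Vi"
  "edge_cond Vk (Vp l)"
  "edge_cond (Vp l) Vj"
  "edge_cond (Vp l) (Vq l)"
  "edge_cond (Vp l) (Vq (l - 1))"
  "edge_cond (Vq l) Vk"
  "edge_cond (Vq l) (Vr (l + 1))"
  "edge_cond (Vr l) (Vp l)"
  "edge_cond (Vr l) (Vp (l - 1))"
  unfolding edge_cond_def
  apply -
  apply (simp_all add: evaluate sum_mod3[of _ l])
  apply (unfold phi_values)
  apply (simp_all add: sq_values field_simps weight_reduce e_square)
  done

lemma row_conds:
  "row_cond Vi Vj Vj"
  "row_cond Vj Vk Vk"
  "row_cond Vj Vk (Vr l)"
  "row_cond Vj (Vr l) (Vr l)"
  "row_cond Vj (Vr l) (Vr (l + 1))"
  "row_cond Vk Vi Vi"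
  "row_cond Vk Vi (Vp l)"
  "row_cond Vk (Vp l) (Vp l)"
  "row_cond Vk (Vp l) (Vp (l + 1))"
  "row_cond (Vp l) Vj Vj"
  "row_cond (Vp l) Vj (Vq l)"
  "row_cond (Vp l) Vj (Vq (l - 1))"
  "row_cond (Vp l) (Vq l) (Vq l)"
  "row_cond (Vp l) (Vq (l - 1)) (Vq (l - 1))"
  "row_cond (Vp l) (Vq l) (Vq (l - 1))"
  "row_cond (Vq l) Vk Vk"
  "row_cond (Vq l) Vk (Vr (l + 1))"
  "row_cond (Vq l) (Vr (l + 1)) (Vr (l + 1))"
  "row_cond (Vr l) (Vp l) (Vp l)"
  "row_cond (Vr l) (Vp (l - 1)) (Vp (l - 1))"
  "row_cond (Vr l) (Vp l) (Vp (l - 1))"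
  unfolding row_cond_def
  apply -
  apply (simp_all add: evaluate sum_mod3[of _ l] inverse_phi divide_inverse[of _ "E2_phi _"])
  apply (unfold phi_values)
  apply (simp_all add: sq_values field_simps weight_reduce e_square)
  done

lemma column_conds:
  "column_cond Vi Vj (Vp l)"
  "column_cond (Vp l) Vj (Vp (l + 1))"
  "column_cond Vj Vk (Vq l)"
  "column_cond (Vq l) Vk (Vq (l + 1))"
  "column_cond Vk (Vp l) (Vr l)"
  "column_cond Vk (Vp l) (Vr (l + 1))"
  "column_cond (Vr l) (Vp l) (Vr (l + 1))"
  "column_cond (Vp l) (Vq l) (Vp (l + 1))"
  "column_cond Vj (Vr l) (Vq (l - 1))"
  unfolding column_cond_def
  apply -
  apply (simp_all add: evaluate sum_mod3[of _ l] inverse_phi divide_inverse[of _ "E2_phi _"])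
  apply (unfold phi_values)
  apply (simp_all add: sq_values field_simps weight_reduce e_square)
  done

lemma edge_all: "E2.arc x y \<Longrightarrow> edge_cond x y"
  using edge_conds by (cases x) (auto simp: arc_from)

lemma row_all:
  assumes "E2.arc x y" "E2.arc x z"
  shows "row_cond x y z"
proof -
  have "row_cond Vj (Vr l) (Vr m)" "row_cond Vk (Vp l) (Vp m)" for l m
    using mod3_cases[of m l] row_conds(4,5,8,9)[of l] row_conds(5,9)[of m, THEN row_cond_sym] by auto
  then show ?thesis
    using assms row_conds row_conds[THEN row_cond_sym]
    by (cases x) (auto simp: arc_from)
qed

lemma column_all:
  assumes "E2.arc x y" "E2.arc z y" "x \<noteq> z"
  shows "column_cond x y z"
proof -
  have "column_cond (Vp l) Vj (Vp m)" "column_cond (Vq l) Vk (Vq m)" if "l \<noteq> m" for l m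
    using that mod3_cases[of m l] column_conds(2,4)[of l] column_conds(2,4)[of m, THEN column_cond_sym] by auto
  then show ?thesis
    using assms column_conds column_conds[THEN column_cond_sym]
    by (cases y) (auto simp: arc_to)
qed

definition E2_W_real :: "E2_vertex \<Rightarrow> E2_vertex \<Rightarrow> E2_vertex \<Rightarrow> real" where
  "E2_W_real x y z = Re (E2.val (E2_W \<epsilon>) x y z)"

lemma of_real_E2_W_real: "E2.val (E2_W \<epsilon>) x y z = of_real (E2_W_real x y z)"
  by (simp add: E2_W_real_def E2.val_def E2_W_def Let_def)

definition real_zigzag :: "E2_vertex \<Rightarrow> E2_vertex \<Rightarrow> E2_vertex \<Rightarrow> E2_vertex \<Rightarrow> real" where
  "real_zigzag x1 x2 x3 x4 = (\<Sum>k\<in>UNIV. inverse (E2_phi k) * E2_W_real x1 x2 k * E2_W_real x3 x2 k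
     * E2_W_real x3 x4 k * E2_W_real x1 x4 k)"

lemma zigzag_E2_W: "E2.zigzag E2_phi (E2_W \<epsilon>) x1 x2 x3 x4 = of_real (real_zigzag x1 x2 x3 x4)"
  by (simp add: E2.zigzag_def real_zigzag_def of_real_E2_W_real)

lemma real_zigzag_swap: "real_zigzag x1 x2 x3 x4 = real_zigzag x3 x2 x1 x4" "real_zigzag x1 x2 x3 x4 = real_zigzag x1 x4 x3 x2"
  by (simp_all add: real_zigzag_def mult_ac)

lemma E2_W_real_values:
  "E2_W_real Vj Vk Vi = E2_W_real Vi Vj Vk" "E2_W_real Vk Vi y = E2_W_real Vi y Vk"
  "E2_W_real Vj z (Vp l) = E2_W_real (Vp l) Vj z" "E2_W_real (Vq m) z (Vp l) = E2_W_real (Vp l) (Vq m) z"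
  "E2_W_real Vk (Vp l) y = E2_W_real (Vp l) y Vk" "E2_W_real (Vr n) (Vp l) y = E2_W_real (Vp l) y (Vr n)"
  "E2_W_real Vi Vj Vk = w_ijk"
  "E2_W_real (Vp l) Vj Vk = w_pjk"
  "E2_W_real (Vp l) (Vq m) Vk = (if m = l then w_pqk \<epsilon> else if m = l - 1 then w_pqk (- \<epsilon>) else 0)"
  "E2_W_real (Vp l) Vj (Vr n) = (if n = l + 1 then w_pqk \<epsilon> else if n = l then w_pqk (- \<epsilon>) else 0)"
  "E2_W_real (Vp l) (Vq m) (Vr n) = (if m = l - 1 \<and> n = l then w_pqr \<epsilon>
     else if m = l \<and> n = l + 1 then - w_pqr (- \<epsilon>) else 0)"
  unfolding E2_W_real_def by (simp_all add: val_rotations[OF E2_W_rotate] E2_W_values)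

lemma E2_W_real_zero: "\<not> E2.tri x y z \<Longrightarrow> E2_W_real x y z = 0"
  by (simp add: E2_W_real_def E2.val_zero)

lemmas evaluate_real = sum_vertices E2_W_real_values E2_W_real_zero E2.tri_def arc_from inverse_phi

lemma w_products: "w_pjk * w_pjk = q2 * (3 + rt3) / 3" "w_pqr \<epsilon> * w_pqr (- \<epsilon>) = q2 * (1 + rt3) / 3"
  using w_squares(2,5) \<epsilon> by (auto simp: mult.commute)

text \<open>Both sides are squared moduli times \<open>w_pqr\<close>; multiplying by \<open>w_pqr (- \<epsilon>)\<close> leaves only
  squares and the known product \<open>w_pqr \<epsilon> * w_pqr (- \<epsilon>)\<close>.\<close>

lemma w_octahedron: "w_pqk (- \<epsilon>) * w_pqk (- \<epsilon>) * w_pqr \<epsilon> = w_pqk \<epsilon> * w_pqk \<epsilon> * w_pqr (- \<epsilon>)"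
proof -
  have "- \<epsilon> \<in> {1, -1}"
    using \<epsilon> by auto
  note w_squares(3,4)[OF \<epsilon>] w_squares(3,4)[OF this]
  note sq = this[folded sq_pqk_def sq_pqr_def]
  have "w_pqk (- \<epsilon>) * w_pqk (- \<epsilon>) * (w_pqr \<epsilon> * w_pqr (- \<epsilon>)) = w_pqk \<epsilon> * w_pqk \<epsilon> * (w_pqr (- \<epsilon>) * w_pqr (- \<epsilon>))"
    unfolding sq w_products sq_values by (simp add: field_simps weight_reduce e_square)
  moreover have "w_pqr (- \<epsilon>) \<noteq> 0"
  proof
    assume "w_pqr (- \<epsilon>) = 0"
    with w_products(2) have "q2 * (1 + rt3) = 0"
      by simp
    moreover have "q2 * (1 + rt3) > 0"
      using weight_relations(4,5) by (intro mult_pos_pos) linarith+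
    ultimately show False
      by linarith
  qed
  ultimately show ?thesis
    by (simp add: mult.assoc[symmetric])
qed

text \<open>The three ways to put a zigzag on two antipodal pairs of an octahedron, with the apexes in the
  third pair. The negative sign of the solution on \<open>p_l, q_l, r_(l+1)\<close> makes the two terms cancel.\<close>

lemma real_zigzag_values:
  "real_zigzag (Vp l) Vj (Vp (l + 1)) (Vq l) = 0"
  "real_zigzag Vj Vk (Vq l) (Vr (l + 1)) = 0"
  "real_zigzag Vk (Vp l) (Vr (l + 1)) (Vp (l + 1)) = 0"
proof -
  have *: "(rt3 - 1) * (w_pjk * w_pjk) = (3 - rt3) * (w_pqr \<epsilon> * w_pqr (- \<epsilon>))"
    unfolding w_products by (simp add: field_simps weight_reduce)
  have "real_zigzag (Vp l) Vj (Vp (l + 1)) (Vq l)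
     = w_pqk \<epsilon> * w_pqk (- \<epsilon>) / 2 * ((rt3 - 1) * (w_pjk * w_pjk) - (3 - rt3) * (w_pqr \<epsilon> * w_pqr (- \<epsilon>)))"
    unfolding real_zigzag_def by (simp add: evaluate_real sum_mod3[of _ l]) (simp add: field_simps)
  with * show "real_zigzag (Vp l) Vj (Vp (l + 1)) (Vq l) = 0"
    by simp
  have "real_zigzag Vk (Vp l) (Vr (l + 1)) (Vp (l + 1))
     = w_pqk \<epsilon> * w_pqk (- \<epsilon>) / 2 * ((rt3 - 1) * (w_pjk * w_pjk) - (3 - rt3) * (w_pqr \<epsilon> * w_pqr (- \<epsilon>)))"
    unfolding real_zigzag_def by (simp add: evaluate_real sum_mod3[of _ l]) (simp add: field_simps)
  with * show "real_zigzag Vk (Vp l) (Vr (l + 1)) (Vp (l + 1)) = 0"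
    by simp
  have "real_zigzag Vj Vk (Vq l) (Vr (l + 1))
     = (2 * rt3 - 3) * w_pjk * (w_pqk (- \<epsilon>) * w_pqk (- \<epsilon>) * w_pqr \<epsilon> - w_pqk \<epsilon> * w_pqk \<epsilon> * w_pqr (- \<epsilon>))"
    unfolding real_zigzag_def by (simp add: evaluate_real sum_mod3[of _ l]) (simp add: field_simps)
  with w_octahedron show "real_zigzag Vj Vk (Vq l) (Vr (l + 1)) = 0"
    by simp
qed

text \<open>Two distinct vertices with two common successors are an antipodal pair of an octahedron, so up to
  the two reflections of a zigzag the previous lemma covers all nondegenerate cases.\<close>

lemma real_zigzag_all:
  assumes "E2.arc x1 x2" "E2.arc x3 x2" "E2.arc x3 x4" "E2.arc x1 x4" "x1 \<noteq> x3" "x2 \<noteq> x4"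
  shows "real_zigzag x1 x2 x3 x4 = 0"
proof -
  note z1 = real_zigzag_values real_zigzag_values[of "l - 1" for l, simplified]
  note z2 = z1 z1[THEN trans[OF real_zigzag_swap(1)]]
  note z3 = z2 z2[THEN trans[OF real_zigzag_swap(2)]]
  show ?thesis
    using assms z3 by (cases x1; cases x3) (auto simp: arc_from)
qed

lemma cell_system_E2_W: "cell_system E2_12 E2_phi (E2_W \<epsilon>)"
  unfolding cell_system_def E2.rotation_iff E2.cell_type_I_iff E2.cell_type_II_iff zigzag_E2_W
  using E2_W_rotate edge_all row_all column_all real_zigzag_all
  by (auto simp: edge_cond_def row_cond_def column_cond_def)

end

section \<open>The moduli of an arbitrary cell system\<close>

lemma sq_pos: "\<epsilon> \<in> {1, -1} \<Longrightarrow> sq_pqk \<epsilon> > 0" "\<epsilon> \<in> {1, -1} \<Longrightarrow> sq_pqr \<epsilon> > 0"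
proof -
  assume "\<epsilon> \<in> {1, -1}"
  then have "\<epsilon> * disc = disc \<or> \<epsilon> * disc = - disc" by auto
  then have "3 + 2 * rt3 + \<epsilon> * disc > 0" "2 + rt3 + \<epsilon> * disc > 0"
    using weight_relations(5-7) by linarith+
  then show "sq_pqk \<epsilon> > 0" "sq_pqr \<epsilon> > 0"
    using weight_relations(4) by (simp_all add: sq_pqk_def sq_pqr_def)
qed

lemma disc_reduce: "disc * disc = 3 + 2 * rt3" "disc * (disc * x) = (3 + 2 * rt3) * x"
  using weight_relations(3) by (simp_all flip: mult.assoc)

context
  fixes W
  assumes W: "cell_system E2_12 E2_phi W"
begin

lemma val_rotate: "E2.val W x y z = E2.val W y z x"
  using W unfolding cell_system_def E2.rotation_iff by blast

lemma edge: "E2.arc x y \<Longrightarrow> (\<Sum>z\<in>UNIV. E2.sq W x y z) = qint 2 * E2_phi x * E2_phi y"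
  using W unfolding cell_system_def E2.cell_type_I_iff by blast

lemma row: "E2.arc x y \<Longrightarrow> E2.arc x z \<Longrightarrow> (\<Sum>k\<in>UNIV. E2.sq W x y k * E2.sq W x z k / E2_phi k)
         = (if y = z then E2_phi x * E2_phi x * E2_phi y else 0) + E2_phi x * E2_phi y * E2_phi z"
  using W unfolding cell_system_def E2.cell_type_II_iff by blast

lemma octahedron: "E2.zigzag E2_phi W (Vp l) Vj (Vp (l + 1)) (Vq l) = 0"
  using W by (simp add: cell_system_def E2.cell_type_II_iff arc_from)

text \<open>The suffix \<open>up\<close> marks the triangles through \<open>q_l\<close> or \<open>r_(l+1)\<close>, the suffix \<open>low\<close> those through
  \<open>q_(l-1)\<close> or \<open>r_l\<close>.\<close>

abbreviation (input) "pjr_up l \<equiv> E2.sq W (Vp l) Vj (Vr (l + 1))"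
abbreviation (input) "pjr_low l \<equiv> E2.sq W (Vp l) Vj (Vr l)"
abbreviation (input) "pqk_up l \<equiv> E2.sq W (Vp l) (Vq l) Vk"
abbreviation (input) "pqk_low l \<equiv> E2.sq W (Vp l) (Vq (l - 1)) Vk"
abbreviation (input) "pqr_up l \<equiv> E2.sq W (Vp l) (Vq l) (Vr (l + 1))"
abbreviation (input) "pqr_low l \<equiv> E2.sq W (Vp l) (Vq (l - 1)) (Vr l)"

lemmas evaluate_cell = sum_vertices sq_rotations[OF val_rotate] sq_zero E2.tri_def arc_from

text \<open>Type I equations. Where a sum has two terms, its value is written in the moduli of the solution
  with sign \<open>\<epsilon>\<close>, which satisfies the same equations; it is the same for both signs.\<close>

lemma edge_equations:
  "E2.sq W Vi Vj Vk = q2 * (1 + rt3)"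
  "E2.sq W (Vp l) Vj Vk + pjr_up l + pjr_low l = q2 * E2_phi (Vp l) * E2_phi Vj"
  "pqk_up l + pqr_up l = sq_pqk \<epsilon> + sq_pqr (- \<epsilon>)"
  "pqk_low l + pqr_low l = sq_pqk \<epsilon> + sq_pqr (- \<epsilon>)"
  "pjr_low l + pqr_low l = sq_pqk \<epsilon> + sq_pqr (- \<epsilon>)"
  "pjr_up l + pqr_up l = sq_pqk \<epsilon> + sq_pqr (- \<epsilon>)"
  "pqk_up l + pqk_low (l + 1) = sq_pqk \<epsilon> + sq_pqk (- \<epsilon>)"
proof -
  have S: "sq_pqk \<epsilon> + sq_pqr (- \<epsilon>) = q2 * E2_phi (Vp l) * E2_phi (Vq l)"
    "sq_pqk \<epsilon> + sq_pqk (- \<epsilon>) = q2 * E2_phi (Vq l) * E2_phi Vk"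
    "E2_phi (Vr m) = E2_phi (Vq l)" for m
    unfolding sq_pqk_def sq_pqr_def phi_values by (simp_all add: field_simps weight_reduce)
  show "E2.sq W Vi Vj Vk = q2 * (1 + rt3)"
    using edge[of Vi Vj] by (simp add: evaluate_cell sum_mod3[of _ 0] phi_values)
  show "E2.sq W (Vp l) Vj Vk + pjr_up l + pjr_low l = q2 * E2_phi (Vp l) * E2_phi Vj"
    using edge[of "Vp l" Vj] by (simp add: evaluate_cell sum_mod3[of _ l])
  show "pqk_up l + pqr_up l = sq_pqk \<epsilon> + sq_pqr (- \<epsilon>)"
    using edge[of "Vp l" "Vq l"] by (simp add: evaluate_cell sum_mod3[of _ l] S)
  show "pqk_low l + pqr_low l = sq_pqk \<epsilon> + sq_pqr (- \<epsilon>)"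
    using edge[of "Vp l" "Vq (l - 1)"] by (simp add: evaluate_cell sum_mod3[of _ l] S) (simp add: phi_values)
  show "pjr_low l + pqr_low l = sq_pqk \<epsilon> + sq_pqr (- \<epsilon>)"
    using edge[of "Vr l" "Vp l"] by (simp add: evaluate_cell sum_mod3[of _ l] S mult_ac)
  show "pjr_up l + pqr_up l = sq_pqk \<epsilon> + sq_pqr (- \<epsilon>)"
    using edge[of "Vr (l + 1)" "Vp l"] by (simp add: evaluate_cell sum_mod3[of _ l] S mult_ac)
  show "pqk_up l + pqk_low (l + 1) = sq_pqk \<epsilon> + sq_pqk (- \<epsilon>)"
    using edge[of "Vq l" Vk] by (simp add: evaluate_cell sum_mod3[of _ l] S)
qed

text \<open>Type II for the edge \<open>p_l \<rightarrow> q_l\<close> is a relation between the squares of \<open>pqk_up l\<close> and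
  \<open>pqr_up l\<close>, and type I gives their sum. Eliminating \<open>pqr_up l\<close> leaves a quadratic equation; it is
  monic because \<open>inverse (E2_phi Vk) + inverse (E2_phi (Vr l)) = 1\<close>.\<close>

lemma pqk_quadratic: "pqk_up l = sq_pqk 1 \<or> pqk_up l = sq_pqk (-1)"
proof -
  have row: "pqk_up l * pqk_up l * inverse (E2_phi Vk) + pqr_up l * pqr_up l * inverse (E2_phi (Vr (l + 1)))
      = E2_phi (Vp l) * E2_phi (Vp l) * E2_phi (Vq l) + E2_phi (Vp l) * E2_phi (Vq l) * E2_phi (Vq l)"
    using row[of "Vp l" "Vq l" "Vq l"] by (simp add: evaluate_cell sum_mod3[of _ l] divide_inverse)
  define y where "y = pqk_up l"
  have "pqr_up l = sq_pqk 1 + sq_pqr (-1) - y"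
    using edge_equations(3)[of l 1] by (simp add: y_def)
  note row = row[folded y_def, unfolded inverse_phi this, unfolded phi_values]
  have "(y - sq_pqk 1) * (y - sq_pqk (-1))
      = (y * y * ((rt3 - 1) / 2) + (sq_pqk 1 + sq_pqr (-1) - y) * (sq_pqk 1 + sq_pqr (-1) - y) * ((3 - rt3) / 2))
        - ((3 + 2 * rt3) / 3 * ((3 + 2 * rt3) / 3) * ((3 + rt3) / 3)
           + (3 + 2 * rt3) / 3 * ((3 + rt3) / 3) * ((3 + rt3) / 3))"
    unfolding sq_pqk_def sq_pqr_def by (simp add: field_simps weight_reduce disc_reduce)
  with row have "(y - sq_pqk 1) * (y - sq_pqk (-1)) = 0"
    by simp
  then show ?thesis
    by (simp add: y_def)
qed

lemma pqk_product: "pqk_up l * pqk_low l = sq_pqk 1 * sq_pqk (-1)"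
proof -
  have "pqk_up l * pqk_low l * inverse (E2_phi Vk) = E2_phi (Vp l) * E2_phi (Vq l) * E2_phi (Vq (l - 1))"
    using row[of "Vp l" "Vq l" "Vq (l - 1)"] by (simp add: evaluate_cell sum_mod3[of _ l] divide_inverse)
  also have "\<dots> = sq_pqk 1 * sq_pqk (-1) * inverse (E2_phi Vk)"
    unfolding inverse_phi unfolding phi_values sq_pqk_def by (simp add: field_simps weight_reduce disc_reduce)
  finally show ?thesis
    using weight_relations(5) by (simp add: inverse_phi)
qed

text \<open>Since \<open>pqk_up l\<close> is one root, \<open>pqk_product\<close> makes \<open>pqk_low l\<close> the other. The edge \<open>q_l \<rightarrow> k\<close>
  then transports the sign from \<open>l\<close> to \<open>l + 1\<close>, and two steps from index 0 reach the other two indices.\<close>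

lemma moduli:
  obtains \<epsilon> where "\<epsilon> \<in> {1, -1}" "E2.sq W = E2.sq (E2_W \<epsilon>)"
proof -
  obtain \<epsilon> where \<epsilon>: "\<epsilon> \<in> {1, -1}" and E0: "pqk_up 0 = sq_pqk \<epsilon>"
    using pqk_quadratic[of 0] by auto
  have nz: "sq_pqk \<epsilon> \<noteq> 0" "sq_pqk (- \<epsilon>) \<noteq> 0"
    using sq_pos(1)[of \<epsilon>] sq_pos(1)[of "- \<epsilon>"] \<epsilon> by auto
  have prod: "pqk_up l * pqk_low l = sq_pqk \<epsilon> * sq_pqk (- \<epsilon>)" for l
    using pqk_product[of l] \<epsilon> by (auto simp: mult.commute)
  have step: "pqk_up (l + 1) = sq_pqk \<epsilon>" if "pqk_up l = sq_pqk \<epsilon>" for l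
    using edge_equations(7)[of l \<epsilon>] prod[of "l + 1"] that nz by simp
  have E: "pqk_up l = sq_pqk \<epsilon>" for l
    using mod3_cases[of l 0] E0 step[OF E0] step[OF step[OF E0], unfolded mod3_simps(7)]
    by (elim disjE) (simp_all only:)
  have F: "pqk_low l = sq_pqk (- \<epsilon>)" for l
    using prod[of l] nz by (simp add: E)
  have G: "pqr_up l = sq_pqr (- \<epsilon>)" for l
    using edge_equations(3)[of l \<epsilon>] E[of l] by simp
  have H: "pqr_low l = sq_pqr \<epsilon>" for l
    using edge_equations(4)[of l "- \<epsilon>"] F[of l] by simp
  have D: "pjr_low l = sq_pqk (- \<epsilon>)" for l
    using edge_equations(5)[of l "- \<epsilon>"] H[of l] by simp
  have C: "pjr_up l = sq_pqk \<epsilon>" for l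
    using edge_equations(6)[of l \<epsilon>] G[of l] by simp
  have B: "E2.sq W (Vp l) Vj Vk = q2 * (3 + rt3) / 3" for l
    using edge_equations(2)[of l] unfolding C D phi_values sq_pqk_def by (simp add: field_simps weight_reduce)
  have "E2.sq W x y z = E2.sq (E2_W \<epsilon>) x y z" for x y z
  proof (cases "E2.tri x y z")
    case True
    then show ?thesis
    proof (induction x y z rule: tri_cases)
      case (rotate x y z)
      then show ?case
        unfolding E2.sq_def by (simp only: val_rotate[of x y z] E2_W_rotate[of _ x y z])
    qed (simp_all add: E2_W_sq[OF \<epsilon>] edge_equations(1) B C D E F G H)
  qed (simp add: sq_zero)
  with that \<epsilon> show thesis
    by blast
qed

end

section \<open>The phases of an arbitrary cell system\<close>

lemma E2_W_nonzero:
  assumes "\<epsilon> \<in> {1, -1}" "E2.tri x y z"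
  shows "E2.val (E2_W \<epsilon>) x y z \<noteq> 0"
proof -
  have pos: "q2 * (1 + rt3) > 0" "q2 * (3 + rt3) / 3 > 0"
    using weight_relations(4,5) by (auto intro!: mult_pos_pos add_pos_pos)
  have "- \<epsilon> \<in> {1, -1}"
    using assms(1) by auto
  note pos = pos sq_pos[OF assms(1)] sq_pos[OF this]
  from assms(2) have "E2.sq (E2_W \<epsilon>) x y z > 0"
  proof (induction x y z rule: tri_cases)
    case (rotate x y z)
    then show ?case
      unfolding E2.sq_def by (simp only: E2_W_rotate[of _ x y z])
  qed (use pos in \<open>simp_all add: E2_W_sq[OF assms(1)]\<close>)
  then show ?thesis
    by (auto simp: E2.sq_def)
qed

text \<open>The common apexes of \<open>p_l \<rightarrow> j \<leftarrow> p_(l+1) \<rightarrow> q_l \<leftarrow> p_l\<close> are \<open>k\<close> and \<open>r_(l+1)\<close>.\<close>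

lemma octahedron_terms:
  assumes rot: "\<And>x y z. E2.val W x y z = E2.val W y z x"
  shows "E2.zigzag E2_phi W (Vp l) Vj (Vp (l + 1)) (Vq l)
    = of_real (inverse (E2_phi Vk)) * E2.val W (Vp l) Vj Vk * cnj (E2.val W (Vp (l + 1)) Vj Vk)
        * E2.val W (Vp (l + 1)) (Vq l) Vk * cnj (E2.val W (Vp l) (Vq l) Vk)
      + of_real (inverse (E2_phi (Vr (l + 1)))) * E2.val W (Vp l) Vj (Vr (l + 1)) * cnj (E2.val W (Vp (l + 1)) Vj (Vr (l + 1)))
        * E2.val W (Vp (l + 1)) (Vq l) (Vr (l + 1)) * cnj (E2.val W (Vp l) (Vq l) (Vr (l + 1)))"
  by (simp add: E2.zigzag_def sum_vertices sum_mod3[of _ l] E2.val_zero E2.tri_def arc_from)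

text \<open>Edge phases whose product over each triangle is to be the given triangle phase \<open>t\<close>. They are
  found by setting the phase to 1 on \<open>j \<rightarrow> k\<close> and on all edges \<open>k \<rightarrow> i\<close>, \<open>k \<rightarrow> p_l\<close>, \<open>q_l \<rightarrow> k\<close>,
  \<open>j \<rightarrow> r_l\<close>, and solving successively for the triangles \<open>i, j, k\<close>; \<open>p_l, j, k\<close>;
  \<open>p_l, q_m, k\<close>; \<open>p_l, j, r_n\<close>; and \<open>p_l, q_l, r_(l+1)\<close>.\<close>

fun gauge :: "(E2_vertex \<Rightarrow> E2_vertex \<Rightarrow> E2_vertex \<Rightarrow> complex) \<Rightarrow> E2_vertex \<Rightarrow> E2_vertex \<Rightarrow> complex" where
  "gauge t Vi Vj = t Vi Vj Vk"
| "gauge t (Vp l) Vj = t (Vp l) Vj Vk"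
| "gauge t (Vp l) (Vq m) = t (Vp l) (Vq m) Vk"
| "gauge t (Vr n) (Vp l) = t (Vp l) Vj (Vr n) / t (Vp l) Vj Vk"
| "gauge t (Vq l) (Vr n) = t (Vp l) (Vq l) (Vr n) * t (Vp l) Vj Vk / (t (Vp l) (Vq l) Vk * t (Vp l) Vj (Vr n))"
| "gauge t _ _ = 1"

lemma cmod_gauge: "(\<And>x y z. cmod (t x y z) = 1) \<Longrightarrow> cmod (gauge t x y) = 1"
  by (cases x; cases y) (simp_all add: norm_divide norm_mult)

text \<open>All triangles but \<open>p_l, q_(l-1), r_l\<close> were used to define \<open>gauge\<close>. For this last one, all
  three edge phases are already fixed, and the condition on the octahedron with index \<open>l - 1\<close> is exactly what
  is needed.\<close>

lemma gauge_triangle: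
  fixes t :: "E2_vertex \<Rightarrow> E2_vertex \<Rightarrow> E2_vertex \<Rightarrow> complex"
  assumes nz: "\<And>x y z. t x y z \<noteq> 0"
    and rot: "\<And>x y z. t x y z = t y z x"
    and oct: "\<And>l. t (Vp l) Vj Vk / t (Vp (l + 1)) Vj Vk * t (Vp (l + 1)) (Vq l) Vk / t (Vp l) (Vq l) Vk
      = t (Vp l) Vj (Vr (l + 1)) / t (Vp (l + 1)) Vj (Vr (l + 1)) * t (Vp (l + 1)) (Vq l) (Vr (l + 1))
        / t (Vp l) (Vq l) (Vr (l + 1))"
    and "E2.tri x y z"
  shows "t x y z = gauge t x y * gauge t y z * gauge t z x"
  using assms(4)
proof (induction x y z rule: tri_cases)
  case (rotate x y z)
  then show ?case
    using rot[of x y z] by (simp add: mult_ac)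
next
  case (pqr' l)
  show ?case
    using oct[of "l - 1"] nz by (simp add: field_simps)
qed (use nz in \<open>simp_all add: field_simps\<close>)

text \<open>Both systems satisfy the octahedron equation. If its two terms are \<open>X\<close> and \<open>Y\<close> for \<open>E2_W \<epsilon>\<close>, they
  are \<open>T1 * X\<close> and \<open>T2 * Y\<close> for \<open>W\<close>, where \<open>T1\<close> and \<open>T2\<close> are each made up of four phases
  of \<open>W\<close> relative to \<open>E2_W \<epsilon>\<close>. From \<open>X + Y = 0\<close>, \<open>T1 * X + T2 * Y = 0\<close> and \<open>X \<noteq> 0\<close> it follows that \<open>T1 = T2\<close>.\<close>

lemma same_moduli_equiv:
  assumes W: "cell_system E2_12 E2_phi W" and \<epsilon>: "\<epsilon> \<in> {1, -1}"
    and moduli: "E2.sq W = E2.sq (E2_W \<epsilon>)"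
  shows "cell_equiv E2_12 W (E2_W \<epsilon>)"
proof -
  define t where "t x y z = (if E2.tri x y z then E2.val W x y z / E2.val (E2_W \<epsilon>) x y z else 1)" for x y z
  note nz = E2_W_nonzero[OF \<epsilon>]
  have W': "cell_system E2_12 E2_phi (E2_W \<epsilon>)"
    using cell_system_E2_W[OF \<epsilon> refl] .
  have "cmod (E2.val W x y z) = cmod (E2.val (E2_W \<epsilon>) x y z)" for x y z
    using moduli[THEN fun_cong, THEN fun_cong, THEN fun_cong, of x y z] by (simp add: E2.sq_def)
  then have cmod_t: "cmod (t x y z) = 1" for x y z
    using nz[of x y z] by (simp add: t_def norm_divide)
  then have t0: "t x y z \<noteq> 0" for x y z
    by (metis norm_zero zero_neq_one)
  have cnj_t: "cnj (t x y z) = 1 / t x y z" for x y z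
    using cmod_t[of x y z] t0[of x y z] complex_norm_square[of "t x y z"] by (simp add: field_simps)
  have val: "E2.val W x y z = t x y z * E2.val (E2_W \<epsilon>) x y z" for x y z
    using nz[of x y z] by (simp add: t_def E2.val_zero)
  have rot: "t x y z = t y z x" for x y z
    unfolding t_def val_rotate[OF W, of x y z] E2_W_rotate[of \<epsilon> x y z] by (auto simp: E2.tri_def)
  have oct: "t (Vp l) Vj Vk / t (Vp (l + 1)) Vj Vk * t (Vp (l + 1)) (Vq l) Vk / t (Vp l) (Vq l) Vk
      = t (Vp l) Vj (Vr (l + 1)) / t (Vp (l + 1)) Vj (Vr (l + 1)) * t (Vp (l + 1)) (Vq l) (Vr (l + 1))
        / t (Vp l) (Vq l) (Vr (l + 1))" (is "?T1 = ?T2") for l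
  proof -
    let ?v = "E2.val (E2_W \<epsilon>)"
    define X where "X = of_real (inverse (E2_phi Vk)) * ?v (Vp l) Vj Vk * cnj (?v (Vp (l + 1)) Vj Vk)
        * ?v (Vp (l + 1)) (Vq l) Vk * cnj (?v (Vp l) (Vq l) Vk)"
    define Y where "Y = of_real (inverse (E2_phi (Vr (l + 1)))) * ?v (Vp l) Vj (Vr (l + 1)) * cnj (?v (Vp (l + 1)) Vj (Vr (l + 1)))
        * ?v (Vp (l + 1)) (Vq l) (Vr (l + 1)) * cnj (?v (Vp l) (Vq l) (Vr (l + 1)))"
    have "X + Y = 0"
      using octahedron[OF W', of l] unfolding octahedron_terms[OF E2_W_rotate] X_def Y_def .
    moreover have "?T1 * X + ?T2 * Y = 0"
      using octahedron[OF W, of l] unfolding octahedron_terms[OF val_rotate[OF W]] X_def Y_def val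
      by (simp add: cnj_t mult_ac)
    ultimately have "(?T1 - ?T2) * X = 0"
      by algebra
    moreover have "X \<noteq> 0"
      using weight_relations(5) nz unfolding X_def inverse_phi by (simp add: E2.tri_def arc_from)
    ultimately show ?thesis
      by simp
  qed
  show ?thesis
  proof (rule E2.cell_equiv_gaugeI[where u = "gauge t"])
    show "cmod (gauge t x y) = 1" for x y
      by (rule cmod_gauge) (rule cmod_t)
    show "E2.val W x y z = gauge t x y * gauge t y z * gauge t z x * E2.val (E2_W \<epsilon>) x y z"
      if "E2.tri x y z" for x y z
      unfolding val[of x y z] using gauge_triangle[of t, OF t0 rot oct that] by simp
  qed
qed

section \<open>Classification\<close>

theorem theorem11p1:
  shows "cell_system E2_12 E2_phi E2_W_plus \<and>
         cell_system E2_12 E2_phi E2_W_minus \<and>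
         \<not> cell_equiv E2_12 E2_W_plus E2_W_minus \<and>
         (\<forall>W. cell_system E2_12 E2_phi W \<longrightarrow>
              cell_equiv E2_12 W E2_W_plus \<or> cell_equiv E2_12 W E2_W_minus)"
  unfolding E2_W_plus_def E2_W_minus_def
proof (intro conjI allI impI)
  show "cell_system E2_12 E2_phi (E2_W 1)" "cell_system E2_12 E2_phi (E2_W (- 1))"
    by (rule cell_system_E2_W[OF _ refl]; simp)+
  show "\<not> cell_equiv E2_12 (E2_W 1) (E2_W (- 1))"
  proof
    assume "cell_equiv E2_12 (E2_W 1) (E2_W (- 1))"
    then have "E2.sq (E2_W 1) (Vp 0) (Vq 0) Vk = E2.sq (E2_W (- 1)) (Vp 0) (Vq 0) Vk"
      unfolding E2.sq_def by (simp only: E2.cell_equiv_cmod)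
    then have "sq_pqk 1 = sq_pqk (- 1)"
      by (simp add: E2_W_sq)
    then show False
      using weight_relations(4,6) by (simp add: sq_pqk_def)
  qed
  fix W
  assume W: "cell_system E2_12 E2_phi W"
  obtain \<epsilon> where "\<epsilon> \<in> {1, -1}" "E2.sq W = E2.sq (E2_W \<epsilon>)"
    by (rule moduli[OF W])
  with same_moduli_equiv[OF W] show "cell_equiv E2_12 W (E2_W 1) \<or> cell_equiv E2_12 W (E2_W (- 1))"
    by auto
qed

end
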